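(* Let $(\mathcal{A}, \mathcal{E})$ be a Frobenius category and let $\mathcal{P}$ denote the full subcategory of $\mathcal{A}$ consisting of projective objects. Let $\mathcal{F}\subseteq \mathcal{P}$ be a full additive subcategory satisfying the following conditions: (1) any object $A$ in $\mathcal{A}$ fits into a sequence $A\xrightarrow{i_A} F_A\xrightarrow{p_A} P_A$ in $\mathcal{A}$ such that $i_A$ is a left $\mathcal{F}$-approximation of $A$, $P_A\in \mathcal{P}$, and $p_A$ is a pseudo-cokernel of $i_A$; (2) any object $A$ in $\mathcal{A}$ fits into a sequence $P^A\xrightarrow{i^A} F^A\xrightarrow{p^A} A$ in $\mathcal{A}$ such that $p^A$ is a right $\mathcal{F}$-approximation of $A$, $P^A\in \mathcal{P}$, and $i^A$ is a pseudo-kernel of $p^A$. Then the pair $(\mathcal{A}/[\mathcal{F}], \mathcal{E}_\mathcal{F})$ is a Frobenius category (in particular, $\mathcal{E}_\mathcal{F}$ is an exact structure on the additive category $\mathcal{A}/[\mathcal{F}]$).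
   Context: Exact categories are in the sense of Quillen. For an additive category $\mathcal{A}$, a composable pair $(i,d)$ is a sequence $X\xrightarrow{i}Y\xrightarrow{d}Z$; two composable pairs are isomorphic if there are isomorphisms between the corresponding objects commuting with the morphisms. A kernel-cokernel pair is a composable pair with $i=\ker d$ and $d=\operatorname{coker} i$. An exact structure on $\mathcal{A}$ is a class $\mathcal{E}$ of kernel-cokernel pairs, closed under isomorphisms, whose members $(i,d)$ are called conflations ($i$ is called an inflation, $d$ a deflation), such that: the identity of the zero object is a deflation; deflations are closed under composition; inflations are closed under composition; the pullback of a deflation along any morphism exists and is a deflation; the pushout of an inflation along any morphism exists and is an inflation. The pair $(\mathcal{A},\mathcal{E})$ is then an exact category. An object $P$ is projective if $\operatorname{Hom}_\mathcal{A}(P,-)$ sends conflations to short exact sequences; $\mathcal{A}$ has enough projective objects if each object $X$ admits a deflation $P\to X$ with $P$ projective. Injective objects and having enough injective objects are defined dually. An exact category is Frobenius if it has enough projective and enough injective objects and the class of projective objects coincides with the class of injective objects. For a full additive subcategory $\mathcal{F}\subseteq\mathcal{A}$, $[\mathcal{F}](X,Y)\subseteq \operatorname{Hom}_\mathcal{A}(X,Y)$ is the subgroup of morphisms factoring through an object of $\mathcal{F}$. The factor category $\mathcal{A}/[\mathcal{F}]$ has the same objects as $\mathcal{A}$, Hom groups $\operatorname{Hom}_\mathcal{A}(X,Y)/[\mathcal{F}](X,Y)$, and composition induced from $\mathcal{A}$; it is an additive category. Let $\pi_\mathcal{F}\colon\mathcal{A}\to\mathcal{A}/[\mathcal{F}]$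 be the canonical functor. $\mathcal{E}_\mathcal{F}$ denotes the class of composable pairs in $\mathcal{A}/[\mathcal{F}]$ that are isomorphic to $(\pi_\mathcal{F}(i),\pi_\mathcal{F}(d))$ for some $(i,d)\in\mathcal{E}$. A pseudo-cokernel of a morphism $f\colon X\to Y$ is a morphism $c\colon Y\to C$ with $c\circ f=0$ such that every morphism $c'\colon Y\to C'$ with $c'\circ f=0$ factors (not necessarily uniquely) through $c$. A pseudo-kernel is defined dually: a morphism $k\colon K\to X$ with $f\circ k=0$ such that every $k'\colon K'\to X$ with $f\circ k'=0$ factors through $k$. A right $\mathcal{F}$-approximation of $X$ is a morphism $f\colon F\to X$ with $F\in\mathcal{F}$ such that every morphism from an object of $\mathcal{F}$ to $X$ factors through $f$. A left $\mathcal{F}$-approximation of $X$ is a morphism $f\colon X\to F$ with $F\in\mathcal{F}$ such that every morphism from $X$ to an object of $\mathcal{F}$ factors through $f$. *)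

theory Defs
  imports "HOL-Algebra.Exact_Sequence"
begin

section \<open>Additive categories\<close>

text \<open>
  Morphism sets are indexed by objects and need not be disjoint, so composition and all
  predicates on morphisms carry the relevant objects. The Hom groups are HOL-Algebra groups
  and hence written multiplicatively: \<open>\<otimes>\<close> is the addition of morphisms and \<open>\<one>\<close> the zero morphism.
  \<open>Comp C X Y Z g f\<close> is \<open>g \<circ> f\<close> for \<open>f : X \<rightarrow> Y\<close> and \<open>g : Y \<rightarrow> Z\<close>. Values outside of
  the objects and the Hom groups are irrelevant.
\<close>

record ('o, 'm) precat =
  Obj :: "'o set"
  Hom :: "'o \<Rightarrow> 'o \<Rightarrow> 'm monoid"
  Comp :: "'o \<Rightarrow> 'o \<Rightarrow> 'o \<Rightarrow> 'm \<Rightarrow> 'm \<Rightarrow> 'm"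
  Ident :: "'o \<Rightarrow> 'm"

abbreviation mor :: "('o, 'm) precat \<Rightarrow> 'o \<Rightarrow> 'o \<Rightarrow> 'm set" where
  "mor C X Y \<equiv> carrier (Hom C X Y)"

abbreviation zero_mor :: "('o, 'm) precat \<Rightarrow> 'o \<Rightarrow> 'o \<Rightarrow> 'm" where
  "zero_mor C X Y \<equiv> \<one>\<^bsub>Hom C X Y\<^esub>"

locale preadditive_category =
  fixes C :: "('o, 'm) precat"
  assumes Hom_comm_group: "\<lbrakk>X \<in> Obj C; Y \<in> Obj C\<rbrakk> \<Longrightarrow> comm_group (Hom C X Y)"
    and Ident_closed: "X \<in> Obj C \<Longrightarrow> Ident C X \<in> mor C X X"
    and Comp_closed: "\<lbrakk>X \<in> Obj C; Y \<in> Obj C; Z \<in> Obj C; f \<in> mor C X Y; g \<in> mor C Y Z\<rbrakk>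
      \<Longrightarrow> Comp C X Y Z g f \<in> mor C X Z"
    and Comp_assoc: "\<lbrakk>W \<in> Obj C; X \<in> Obj C; Y \<in> Obj C; Z \<in> Obj C;
        f \<in> mor C W X; g \<in> mor C X Y; h \<in> mor C Y Z\<rbrakk>
      \<Longrightarrow> Comp C W X Z (Comp C X Y Z h g) f = Comp C W Y Z h (Comp C W X Y g f)"
    and Comp_Ident_left: "\<lbrakk>X \<in> Obj C; Y \<in> Obj C; f \<in> mor C X Y\<rbrakk>
      \<Longrightarrow> Comp C X Y Y (Ident C Y) f = f"
    and Comp_Ident_right: "\<lbrakk>X \<in> Obj C; Y \<in> Obj C; f \<in> mor C X Y\<rbrakk>
      \<Longrightarrow> Comp C X X Y f (Ident C X) = f"
    and Comp_add_left: "\<lbrakk>X \<in> Obj C; Y \<in> Obj C; Z \<in> Obj C;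
        f \<in> mor C X Y; g \<in> mor C Y Z; g' \<in> mor C Y Z\<rbrakk>
      \<Longrightarrow> Comp C X Y Z (g \<otimes>\<^bsub>Hom C Y Z\<^esub> g') f = Comp C X Y Z g f \<otimes>\<^bsub>Hom C X Z\<^esub> Comp C X Y Z g' f"
    and Comp_add_right: "\<lbrakk>X \<in> Obj C; Y \<in> Obj C; Z \<in> Obj C;
        f \<in> mor C X Y; f' \<in> mor C X Y; g \<in> mor C Y Z\<rbrakk>
      \<Longrightarrow> Comp C X Y Z g (f \<otimes>\<^bsub>Hom C X Y\<^esub> f') = Comp C X Y Z g f \<otimes>\<^bsub>Hom C X Z\<^esub> Comp C X Y Z g f'"

definition zero_object :: "('o, 'm) precat \<Rightarrow> 'o \<Rightarrow> bool" where
  "zero_object C Z \<longleftrightarrow> Z \<in> Obj C \<and>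
     (\<forall>X \<in> Obj C. (\<exists>!f. f \<in> mor C X Z) \<and> (\<exists>!f. f \<in> mor C Z X))"

definition biproduct ::
  "('o, 'm) precat \<Rightarrow> 'o \<Rightarrow> 'o \<Rightarrow> 'o \<Rightarrow> 'm \<Rightarrow> 'm \<Rightarrow> 'm \<Rightarrow> 'm \<Rightarrow> bool" where
  "biproduct C X Y S i j p q \<longleftrightarrow>
     X \<in> Obj C \<and> Y \<in> Obj C \<and> S \<in> Obj C \<and>
     i \<in> mor C X S \<and> j \<in> mor C Y S \<and> p \<in> mor C S X \<and> q \<in> mor C S Y \<and>
     Comp C X S X p i = Ident C X \<and> Comp C Y S Y q j = Ident C Y \<and>
     Comp C Y S X p j = zero_mor C Y X \<and> Comp C X S Y q i = zero_mor C X Y \<and>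
     Comp C S X S i p \<otimes>\<^bsub>Hom C S S\<^esub> Comp C S Y S j q = Ident C S"

locale additive_category = preadditive_category C
  for C :: "('o, 'm) precat" +
  assumes zero_object_exists: "\<exists>Z. zero_object C Z"
    and biproduct_exists: "\<lbrakk>X \<in> Obj C; Y \<in> Obj C\<rbrakk> \<Longrightarrow> \<exists>S i j p q. biproduct C X Y S i j p q"

text \<open>Full subcategories are given by their sets of objects; closure under isomorphism is not
  required.\<close>

definition full_subcategory :: "('o, 'm) precat \<Rightarrow> 'o set \<Rightarrow> ('o, 'm) precat" where
  "full_subcategory C F = C\<lparr>Obj := F\<rparr>"

definition full_additive_subcategory :: "('o, 'm) precat \<Rightarrow> 'o set \<Rightarrow> bool" where
  "full_additive_subcategory C F \<longleftrightarrow>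
     F \<subseteq> Obj C \<and> additive_category (full_subcategory C F)"


section \<open>Exact structures\<close>

text \<open>\<open>(X, i, Y, d, Z)\<close> stands for a sequence \<open>X \<rightarrow> Y \<rightarrow> Z\<close> with morphisms \<open>i\<close> and \<open>d\<close>.\<close>

type_synonym ('o, 'm) pair = "'o \<times> 'm \<times> 'o \<times> 'm \<times> 'o"

definition composable_pair :: "('o, 'm) precat \<Rightarrow> ('o, 'm) pair \<Rightarrow> bool" where
  "composable_pair C = (\<lambda>(X, i, Y, d, Z).
     X \<in> Obj C \<and> Y \<in> Obj C \<and> Z \<in> Obj C \<and> i \<in> mor C X Y \<and> d \<in> mor C Y Z)"

definition is_iso :: "('o, 'm) precat \<Rightarrow> 'o \<Rightarrow> 'o \<Rightarrow> 'm \<Rightarrow> bool" where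
  "is_iso C X Y f \<longleftrightarrow> f \<in> mor C X Y \<and>
     (\<exists>g \<in> mor C Y X. Comp C X Y X g f = Ident C X \<and> Comp C Y X Y f g = Ident C Y)"

definition isomorphic_pairs :: "('o, 'm) precat \<Rightarrow> ('o, 'm) pair \<Rightarrow> ('o, 'm) pair \<Rightarrow> bool" where
  "isomorphic_pairs C = (\<lambda>(X, i, Y, d, Z) (X', i', Y', d', Z').
     composable_pair C (X, i, Y, d, Z) \<and> composable_pair C (X', i', Y', d', Z') \<and>
     (\<exists>a b c. is_iso C X X' a \<and> is_iso C Y Y' b \<and> is_iso C Z Z' c \<and>
        Comp C X Y Y' b i = Comp C X X' Y' i' a \<and>
        Comp C Y Z Z' c d = Comp C Y Y' Z' d' b))"

definition is_kernel :: "('o, 'm) precat \<Rightarrow> 'o \<Rightarrow> 'o \<Rightarrow> 'o \<Rightarrow> 'm \<Rightarrow> 'm \<Rightarrow> bool" where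
  "is_kernel C X Y Z i d \<longleftrightarrow>
     composable_pair C (X, i, Y, d, Z) \<and> Comp C X Y Z d i = zero_mor C X Z \<and>
     (\<forall>W \<in> Obj C. \<forall>f \<in> mor C W Y. Comp C W Y Z d f = zero_mor C W Z \<longrightarrow>
        (\<exists>!g. g \<in> mor C W X \<and> Comp C W X Y i g = f))"

definition is_cokernel :: "('o, 'm) precat \<Rightarrow> 'o \<Rightarrow> 'o \<Rightarrow> 'o \<Rightarrow> 'm \<Rightarrow> 'm \<Rightarrow> bool" where
  "is_cokernel C X Y Z i d \<longleftrightarrow>
     composable_pair C (X, i, Y, d, Z) \<and> Comp C X Y Z d i = zero_mor C X Z \<and>
     (\<forall>W \<in> Obj C. \<forall>f \<in> mor C Y W. Comp C X Y W f i = zero_mor C X W \<longrightarrow>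
        (\<exists>!g. g \<in> mor C Z W \<and> Comp C Y Z W g d = f))"

definition kernel_cokernel_pair :: "('o, 'm) precat \<Rightarrow> ('o, 'm) pair \<Rightarrow> bool" where
  "kernel_cokernel_pair C = (\<lambda>(X, i, Y, d, Z). is_kernel C X Y Z i d \<and> is_cokernel C X Y Z i d)"

definition inflation :: "('o, 'm) pair set \<Rightarrow> 'o \<Rightarrow> 'o \<Rightarrow> 'm \<Rightarrow> bool" where
  "inflation E X Y i \<longleftrightarrow> (\<exists>Z d. (X, i, Y, d, Z) \<in> E)"

definition deflation :: "('o, 'm) pair set \<Rightarrow> 'o \<Rightarrow> 'o \<Rightarrow> 'm \<Rightarrow> bool" where
  "deflation E Y Z d \<longleftrightarrow> (\<exists>X i. (X, i, Y, d, Z) \<in> E)"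

text \<open>The squares are
  \<open>f \<circ> u = g \<circ> v\<close> with \<open>u : V \<rightarrow> X\<close>, \<open>v : V \<rightarrow> Y\<close>, \<open>f : X \<rightarrow> Z\<close>, \<open>g : Y \<rightarrow> Z\<close> for pullbacks, and
  \<open>u \<circ> f = v \<circ> g\<close> with \<open>f : Z \<rightarrow> X\<close>, \<open>g : Z \<rightarrow> Y\<close>, \<open>u : X \<rightarrow> V\<close>, \<open>v : Y \<rightarrow> V\<close> for pushouts.\<close>

definition is_pullback ::
  "('o, 'm) precat \<Rightarrow> 'o \<Rightarrow> 'o \<Rightarrow> 'o \<Rightarrow> 'm \<Rightarrow> 'm \<Rightarrow> 'o \<Rightarrow> 'm \<Rightarrow> 'm \<Rightarrow> bool" where
  "is_pullback C X Y Z f g V u v \<longleftrightarrow>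
     X \<in> Obj C \<and> Y \<in> Obj C \<and> Z \<in> Obj C \<and> V \<in> Obj C \<and>
     f \<in> mor C X Z \<and> g \<in> mor C Y Z \<and> u \<in> mor C V X \<and> v \<in> mor C V Y \<and>
     Comp C V X Z f u = Comp C V Y Z g v \<and>
     (\<forall>W \<in> Obj C. \<forall>s \<in> mor C W X. \<forall>t \<in> mor C W Y. Comp C W X Z f s = Comp C W Y Z g t \<longrightarrow>
        (\<exists>!w. w \<in> mor C W V \<and> Comp C W V X u w = s \<and> Comp C W V Y v w = t))"

definition is_pushout ::
  "('o, 'm) precat \<Rightarrow> 'o \<Rightarrow> 'o \<Rightarrow> 'o \<Rightarrow> 'm \<Rightarrow> 'm \<Rightarrow> 'o \<Rightarrow> 'm \<Rightarrow> 'm \<Rightarrow> bool" where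
  "is_pushout C X Y Z f g V u v \<longleftrightarrow>
     X \<in> Obj C \<and> Y \<in> Obj C \<and> Z \<in> Obj C \<and> V \<in> Obj C \<and>
     f \<in> mor C Z X \<and> g \<in> mor C Z Y \<and> u \<in> mor C X V \<and> v \<in> mor C Y V \<and>
     Comp C Z X V u f = Comp C Z Y V v g \<and>
     (\<forall>W \<in> Obj C. \<forall>s \<in> mor C X W. \<forall>t \<in> mor C Y W. Comp C Z X W s f = Comp C Z Y W t g \<longrightarrow>
        (\<exists>!w. w \<in> mor C V W \<and> Comp C X V W w u = s \<and> Comp C Y V W w v = t))"

locale exact_category = additive_category C
  for C :: "('o, 'm) precat" +
  fixes E :: "('o, 'm) pair set"
  assumes conflation_kernel_cokernel: "c \<in> E \<Longrightarrow> kernel_cokernel_pair C c"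
    and conflation_iso_closed: "\<lbrakk>c \<in> E; isomorphic_pairs C c c'\<rbrakk> \<Longrightarrow> c' \<in> E"
    and zero_deflation: "zero_object C Z \<Longrightarrow> deflation E Z Z (Ident C Z)"
    and deflation_Comp: "\<lbrakk>deflation E X Y d; deflation E Y Z e\<rbrakk>
      \<Longrightarrow> deflation E X Z (Comp C X Y Z e d)"
    and inflation_Comp: "\<lbrakk>inflation E X Y i; inflation E Y Z j\<rbrakk>
      \<Longrightarrow> inflation E X Z (Comp C X Y Z j i)"
    and deflation_pullback: "\<lbrakk>deflation E Y Z d; X \<in> Obj C; f \<in> mor C X Z\<rbrakk>
      \<Longrightarrow> \<exists>V d' f'. is_pullback C X Y Z f d V d' f' \<and> deflation E V X d'"
    and inflation_pushout: "\<lbrakk>inflation E Z Y i; X \<in> Obj C; f \<in> mor C Z X\<rbrakk>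
      \<Longrightarrow> \<exists>V i' f'. is_pushout C X Y Z f i V i' f' \<and> inflation E X V i'"

text \<open>In the library, \<^term>\<open>short_exact_sequence G3 G2 G1 g f\<close> lists the sequence
  \<open>0 \<rightarrow> G1 \<rightarrow> G2 \<rightarrow> G3 \<rightarrow> 0\<close> with maps \<open>f\<close>, \<open>g\<close> from right to left.\<close>

definition projective_object :: "('o, 'm) precat \<Rightarrow> ('o, 'm) pair set \<Rightarrow> 'o \<Rightarrow> bool" where
  "projective_object C E P \<longleftrightarrow> P \<in> Obj C \<and>
     (\<forall>X i Y d Z. (X, i, Y, d, Z) \<in> E \<longrightarrow>
        short_exact_sequence (Hom C P Z) (Hom C P Y) (Hom C P X) (Comp C P Y Z d) (Comp C P X Y i))"

definition injective_object :: "('o, 'm) precat \<Rightarrow> ('o, 'm) pair set \<Rightarrow> 'o \<Rightarrow> bool" where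
  "injective_object C E I \<longleftrightarrow> I \<in> Obj C \<and>
     (\<forall>X i Y d Z. (X, i, Y, d, Z) \<in> E \<longrightarrow>
        short_exact_sequence (Hom C X I) (Hom C Y I) (Hom C Z I)
          (\<lambda>f. Comp C X Y I f i) (\<lambda>f. Comp C Y Z I f d))"

definition enough_projectives :: "('o, 'm) precat \<Rightarrow> ('o, 'm) pair set \<Rightarrow> bool" where
  "enough_projectives C E \<longleftrightarrow>
     (\<forall>X \<in> Obj C. \<exists>P d. projective_object C E P \<and> deflation E P X d)"

definition enough_injectives :: "('o, 'm) precat \<Rightarrow> ('o, 'm) pair set \<Rightarrow> bool" where
  "enough_injectives C E \<longleftrightarrow>
     (\<forall>X \<in> Obj C. \<exists>I i. injective_object C E I \<and> inflation E X I i)"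

locale frobenius_category = exact_category C E
  for C :: "('o, 'm) precat" and E +
  assumes enough_projectives: "enough_projectives C E"
    and enough_injectives: "enough_injectives C E"
    and projective_iff_injective: "projective_object C E X \<longleftrightarrow> injective_object C E X"


section \<open>Factor categories\<close>

definition factoring_mors :: "('o, 'm) precat \<Rightarrow> 'o set \<Rightarrow> 'o \<Rightarrow> 'o \<Rightarrow> 'm set" where
  "factoring_mors C F X Y =
     {f \<in> mor C X Y. \<exists>W \<in> F. \<exists>g \<in> mor C X W. \<exists>h \<in> mor C W Y. f = Comp C X W Y h g}"

text \<open>Action of the canonical functor on morphisms.\<close>

definition factor_mor :: "('o, 'm) precat \<Rightarrow> 'o set \<Rightarrow> 'o \<Rightarrow> 'o \<Rightarrow> 'm \<Rightarrow> 'm set" where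
  "factor_mor C F X Y f = factoring_mors C F X Y #>\<^bsub>Hom C X Y\<^esub> f"

text \<open>The composite of two cosets is the union of the cosets of the composites of all
  representatives; all of these cosets coincide.\<close>

definition factor_category :: "('o, 'm) precat \<Rightarrow> 'o set \<Rightarrow> ('o, 'm set) precat" where
  "factor_category C F = \<lparr>
     Obj = Obj C,
     Hom = (\<lambda>X Y. Hom C X Y Mod factoring_mors C F X Y),
     Comp = (\<lambda>X Y Z G H. \<Union>g \<in> G. \<Union>f \<in> H. factor_mor C F X Z (Comp C X Y Z g f)),
     Ident = (\<lambda>X. factor_mor C F X X (Ident C X))\<rparr>"

definition factor_conflations ::
  "('o, 'm) precat \<Rightarrow> ('o, 'm) pair set \<Rightarrow> 'o set \<Rightarrow> ('o, 'm set) pair set" where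
  "factor_conflations C E F =
     {c. \<exists>X i Y d Z. (X, i, Y, d, Z) \<in> E \<and>
        isomorphic_pairs (factor_category C F)
          (X, factor_mor C F X Y i, Y, factor_mor C F Y Z d, Z) c}"


section \<open>Pseudo-kernels, pseudo-cokernels and approximations\<close>

definition pseudo_cokernel :: "('o, 'm) precat \<Rightarrow> 'o \<Rightarrow> 'o \<Rightarrow> 'o \<Rightarrow> 'm \<Rightarrow> 'm \<Rightarrow> bool" where
  "pseudo_cokernel C X Y Z f c \<longleftrightarrow>
     composable_pair C (X, f, Y, c, Z) \<and> Comp C X Y Z c f = zero_mor C X Z \<and>
     (\<forall>W \<in> Obj C. \<forall>c' \<in> mor C Y W. Comp C X Y W c' f = zero_mor C X W \<longrightarrow>
        (\<exists>g \<in> mor C Z W. Comp C Y Z W g c = c'))"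

definition pseudo_kernel :: "('o, 'm) precat \<Rightarrow> 'o \<Rightarrow> 'o \<Rightarrow> 'o \<Rightarrow> 'm \<Rightarrow> 'm \<Rightarrow> bool" where
  "pseudo_kernel C K X Y k f \<longleftrightarrow>
     composable_pair C (K, k, X, f, Y) \<and> Comp C K X Y f k = zero_mor C K Y \<and>
     (\<forall>W \<in> Obj C. \<forall>k' \<in> mor C W X. Comp C W X Y f k' = zero_mor C W Y \<longrightarrow>
        (\<exists>g \<in> mor C W K. Comp C W K X k g = k'))"

definition right_approximation :: "('o, 'm) precat \<Rightarrow> 'o set \<Rightarrow> 'o \<Rightarrow> 'o \<Rightarrow> 'm \<Rightarrow> bool" where
  "right_approximation C F X FX f \<longleftrightarrow>
     X \<in> Obj C \<and> FX \<in> F \<and> f \<in> mor C FX X \<and>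
     (\<forall>W \<in> F. \<forall>g \<in> mor C W X. \<exists>h \<in> mor C W FX. Comp C W FX X f h = g)"

definition left_approximation :: "('o, 'm) precat \<Rightarrow> 'o set \<Rightarrow> 'o \<Rightarrow> 'o \<Rightarrow> 'm \<Rightarrow> bool" where
  "left_approximation C F X FX f \<longleftrightarrow>
     X \<in> Obj C \<and> FX \<in> F \<and> f \<in> mor C X FX \<and>
     (\<forall>W \<in> F. \<forall>g \<in> mor C X W. \<exists>h \<in> mor C FX W. Comp C X FX W h f = g)"

end

theory Submission
  imports Defs
begin

text \<open>
  Write \<open>\<pi>\<close> for the canonical functor to \<open>\<A>/[\<F>]\<close>. Conditions (1) and (2) control the two kinds
  of cancellation that could fail in the quotient: (2) makes images of deflations epic and, dually,
  (1) makes images of inflations monic. As the objects of \<open>\<F>\<close> are projective and injective,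
  \<open>\<pi>\<close> therefore sends conflations to kernel-cokernel pairs and pullbacks of deflations to
  pullbacks, without any stabilisation by projectives. A composite of two deflations of the
  quotient is a composite of images of deflations with an isomorphism in between; pulling back along
  a representative of this isomorphism removes it. Finally, an object is projective in the
  quotient iff it is so in \<open>\<A>\<close>: if \<open>\<pi>(d)\<close> splits for a deflation \<open>d\<close>, the error term of the
  splitting factors through \<open>\<F>\<close> and hence lifts along \<open>d\<close>, so that \<open>d\<close> itself splits. The hypotheses
  are self-dual, which yields the statements on inflations and injectives.
\<close>


section \<open>Preadditive categories\<close>

abbreviation diff_mor :: "('o, 'm) precat \<Rightarrow> 'o \<Rightarrow> 'o \<Rightarrow> 'm \<Rightarrow> 'm \<Rightarrow> 'm" where
  "diff_mor C X Y f g \<equiv> f \<otimes>\<^bsub>Hom C X Y\<^esub> inv\<^bsub>Hom C X Y\<^esub> g"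

context preadditive_category
begin

section \<open>Hom groups and bilinearity of composition\<close>

lemmas [simp] = Ident_closed Comp_closed Comp_Ident_left Comp_Ident_right

lemma Hom_group: "X \<in> Obj C \<Longrightarrow> Y \<in> Obj C \<Longrightarrow> group (Hom C X Y)"
  using Hom_comm_group comm_group.axioms(2) by blast

lemma zero_closed [simp]: "X \<in> Obj C \<Longrightarrow> Y \<in> Obj C \<Longrightarrow> zero_mor C X Y \<in> mor C X Y"
  using Hom_group group.is_monoid monoid.one_closed by blast

lemma add_closed [simp]:
  "\<lbrakk>X \<in> Obj C; Y \<in> Obj C; f \<in> mor C X Y; g \<in> mor C X Y\<rbrakk> \<Longrightarrow> f \<otimes>\<^bsub>Hom C X Y\<^esub> g \<in> mor C X Y"
  using Hom_group group.is_monoid monoid.m_closed by fast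

lemma minus_closed [simp]:
  "\<lbrakk>X \<in> Obj C; Y \<in> Obj C; f \<in> mor C X Y\<rbrakk> \<Longrightarrow> inv\<^bsub>Hom C X Y\<^esub> f \<in> mor C X Y"
  using Hom_group group.inv_closed by fast

lemma postcomp_hom:
  assumes "X \<in> Obj C" "Y \<in> Obj C" "Z \<in> Obj C" "g \<in> mor C Y Z"
  shows "group_hom (Hom C X Y) (Hom C X Z) (Comp C X Y Z g)"
  by (intro group_hom.intro group_hom_axioms.intro Hom_group assms homI)
    (use assms in \<open>auto simp: Comp_add_right\<close>)

lemma precomp_hom:
  assumes "X \<in> Obj C" "Y \<in> Obj C" "Z \<in> Obj C" "f \<in> mor C X Y"
  shows "group_hom (Hom C Y Z) (Hom C X Z) (\<lambda>g. Comp C X Y Z g f)"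
  by (intro group_hom.intro group_hom_axioms.intro Hom_group assms homI)
    (use assms in \<open>auto simp: Comp_add_left\<close>)

lemma Comp_zero_right [simp]:
  "\<lbrakk>X \<in> Obj C; Y \<in> Obj C; Z \<in> Obj C; g \<in> mor C Y Z\<rbrakk> \<Longrightarrow> Comp C X Y Z g (zero_mor C X Y) = zero_mor C X Z"
  using group_hom.hom_one[OF postcomp_hom] by fast

lemma Comp_zero_left [simp]:
  "\<lbrakk>X \<in> Obj C; Y \<in> Obj C; Z \<in> Obj C; f \<in> mor C X Y\<rbrakk> \<Longrightarrow> Comp C X Y Z (zero_mor C Y Z) f = zero_mor C X Z"
  using group_hom.hom_one[OF precomp_hom] by fast

lemma Comp_minus_right:
  "\<lbrakk>X \<in> Obj C; Y \<in> Obj C; Z \<in> Obj C; f \<in> mor C X Y; g \<in> mor C Y Z\<rbrakk>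
    \<Longrightarrow> Comp C X Y Z g (inv\<^bsub>Hom C X Y\<^esub> f) = inv\<^bsub>Hom C X Z\<^esub> Comp C X Y Z g f"
  using group_hom.hom_inv[OF postcomp_hom] by fast

lemma Comp_minus_left:
  "\<lbrakk>X \<in> Obj C; Y \<in> Obj C; Z \<in> Obj C; f \<in> mor C X Y; g \<in> mor C Y Z\<rbrakk>
    \<Longrightarrow> Comp C X Y Z (inv\<^bsub>Hom C Y Z\<^esub> g) f = inv\<^bsub>Hom C X Z\<^esub> Comp C X Y Z g f"
  using group_hom.hom_inv[OF precomp_hom] by fast

lemma Comp_diff_right:
  "\<lbrakk>X \<in> Obj C; Y \<in> Obj C; Z \<in> Obj C; f \<in> mor C X Y; f' \<in> mor C X Y; g \<in> mor C Y Z\<rbrakk>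
    \<Longrightarrow> Comp C X Y Z g (diff_mor C X Y f f') = diff_mor C X Z (Comp C X Y Z g f) (Comp C X Y Z g f')"
  by (simp add: Comp_add_right Comp_minus_right)

lemma Comp_diff_left:
  "\<lbrakk>X \<in> Obj C; Y \<in> Obj C; Z \<in> Obj C; f \<in> mor C X Y; g \<in> mor C Y Z; g' \<in> mor C Y Z\<rbrakk>
    \<Longrightarrow> Comp C X Y Z (diff_mor C Y Z g g') f = diff_mor C X Z (Comp C X Y Z g f) (Comp C X Y Z g' f)"
  by (simp add: Comp_add_left Comp_minus_left)

lemma diff_eq_zero_iff:
  assumes "X \<in> Obj C" "Y \<in> Obj C" "f \<in> mor C X Y" "g \<in> mor C X Y"
  shows "diff_mor C X Y f g = zero_mor C X Y \<longleftrightarrow> f = g"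
proof -
  interpret group "Hom C X Y" using Hom_group assms by auto
  show ?thesis using assms by (metis inv_closed inv_equality inv_inv r_inv)
qed

lemma diff_closed: "\<lbrakk>X \<in> Obj C; Y \<in> Obj C; f \<in> mor C X Y; g \<in> mor C X Y\<rbrakk> \<Longrightarrow> diff_mor C X Y f g \<in> mor C X Y"
  by simp

lemma add_eq_iff_eq_diff:
  assumes "X \<in> Obj C" "Y \<in> Obj C" "f \<in> mor C X Y" "g \<in> mor C X Y" "h \<in> mor C X Y"
  shows "f \<otimes>\<^bsub>Hom C X Y\<^esub> g = h \<longleftrightarrow> f = diff_mor C X Y h g"
proof -
  interpret group "Hom C X Y" using Hom_group assms by auto
  show ?thesis using assms inv_solve_right by metis
qed

lemma add_commute:
  assumes "X \<in> Obj C" "Y \<in> Obj C" "f \<in> mor C X Y" "g \<in> mor C X Y"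
  shows "f \<otimes>\<^bsub>Hom C X Y\<^esub> g = g \<otimes>\<^bsub>Hom C X Y\<^esub> f"
  using Hom_comm_group[OF assms(1,2)] assms comm_groupE(4) by fast

lemma diff_diff:
  assumes "X \<in> Obj C" "Y \<in> Obj C" "f \<in> mor C X Y" "g \<in> mor C X Y"
  shows "diff_mor C X Y f (diff_mor C X Y f g) = g"
  by (metis add_commute add_eq_iff_eq_diff assms diff_closed)

text \<open>Every map into or out of \<open>Z\<close> equals its composite with the identity of
  \<open>Z\<close>, so it vanishes with that identity. This recognises zero objects of
  \<open>F\<close> inside \<open>C\<close> and zero objects of the quotient, where the identity is
  the only map to check.\<close>

lemma zero_objectI:
  assumes "Z \<in> Obj C" "Ident C Z = zero_mor C Z Z"
  shows "zero_object C Z"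
  unfolding zero_object_def
proof (intro conjI ballI)
  fix X assume X: "X \<in> Obj C"
  have "f = zero_mor C X Z" if "f \<in> mor C X Z" for f
    using Comp_Ident_left[OF X assms(1) that] X assms that by simp
  then show "\<exists>!f. f \<in> mor C X Z" using X assms zero_closed by blast
  have "f = zero_mor C Z X" if "f \<in> mor C Z X" for f
    using Comp_Ident_right[OF assms(1) X that] X assms that by simp
  then show "\<exists>!f. f \<in> mor C Z X" using X assms zero_closed by blast
qed (fact assms)

lemma zero_object_mor_eq:
  assumes "zero_object C Z" "X \<in> Obj C"
  shows "f \<in> mor C X Z \<Longrightarrow> g \<in> mor C X Z \<Longrightarrow> f = g"
    and "f \<in> mor C Z X \<Longrightarrow> g \<in> mor C Z X \<Longrightarrow> f = g"
  using assms unfolding zero_object_def by blast+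

section \<open>Isomorphisms of objects and of composable pairs\<close>

lemma is_iso_Ident: "X \<in> Obj C \<Longrightarrow> is_iso C X X (Ident C X)"
  unfolding is_iso_def by (auto intro!: bexI[where x = "Ident C X"])

lemma is_iso_Comp:
  assumes "is_iso C X Y f" "is_iso C Y Z g" "X \<in> Obj C" "Y \<in> Obj C" "Z \<in> Obj C"
  shows "is_iso C X Z (Comp C X Y Z g f)"
proof -
  obtain f' g' where f: "f \<in> mor C X Y" "f' \<in> mor C Y X" "Comp C X Y X f' f = Ident C X"
      "Comp C Y X Y f f' = Ident C Y"
    and g: "g \<in> mor C Y Z" "g' \<in> mor C Z Y" "Comp C Y Z Y g' g = Ident C Y"
      "Comp C Z Y Z g g' = Ident C Z"
    using assms unfolding is_iso_def by blast
  have 1: "Comp C Y Z X (Comp C Z Y X f' g') g = f'"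
    using f g assms by (simp add: Comp_assoc)
  have 2: "Comp C Y X Z (Comp C X Y Z g f) f' = g"
    using f g assms by (simp add: Comp_assoc)
  show ?thesis
    unfolding is_iso_def
  proof (intro conjI bexI)
    show "Comp C X Z X (Comp C Z Y X f' g') (Comp C X Y Z g f) = Ident C X"
      using f g assms 1 by (simp add: Comp_assoc[symmetric])
    show "Comp C Z X Z (Comp C X Y Z g f) (Comp C Z Y X f' g') = Ident C Z"
      using f g assms 2 by (simp add: Comp_assoc[symmetric])
  qed (use f g assms in auto)
qed

lemma is_iso_zero:
  assumes "zero_object C Y" "zero_object C Z"
  shows "is_iso C Y Z (zero_mor C Y Z)"
proof -
  have "Y \<in> Obj C" "Z \<in> Obj C" using assms by (auto simp: zero_object_def)
  then show ?thesis
    unfolding is_iso_def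
    using zero_object_mor_eq(1)[OF assms(1)] zero_object_mor_eq(1)[OF assms(2)]
    by (intro conjI bexI[of _ "zero_mor C Z Y"]) simp_all
qed

lemma is_isoE:
  assumes "is_iso C X Y f"
  obtains g where "f \<in> mor C X Y" "g \<in> mor C Y X" "is_iso C Y X g"
    "Comp C X Y X g f = Ident C X" "Comp C Y X Y f g = Ident C Y"
  using assms unfolding is_iso_def by blast

text \<open>Only a one-sided inverse is required, so the rules apply to sections and retractions as
  well as to either half of an isomorphism.\<close>

lemma Comp_cancel:
  assumes "X \<in> Obj C" "Y \<in> Obj C" "g \<in> mor C Y X" "f \<in> mor C X Y" "Comp C X Y X g f = Ident C X"
    "W \<in> Obj C"
  shows "h \<in> mor C W X \<Longrightarrow> Comp C W Y X g (Comp C W X Y f h) = h"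
    and "h \<in> mor C X W \<Longrightarrow> Comp C X Y W (Comp C Y X W h g) f = h"
  using assms by (simp_all add: Comp_assoc[symmetric]) (simp add: Comp_assoc)

lemma isomorphic_pairs_sym:
  assumes "isomorphic_pairs C p q"
  shows "isomorphic_pairs C q p"
proof -
  obtain X i Y d Z X' i' Y' d' Z' where pq: "p = (X, i, Y, d, Z)" "q = (X', i', Y', d', Z')"
    by (metis prod.exhaust)
  obtain a b c where ob: "X \<in> Obj C" "Y \<in> Obj C" "Z \<in> Obj C" "X' \<in> Obj C" "Y' \<in> Obj C" "Z' \<in> Obj C"
    and m: "i \<in> mor C X Y" "d \<in> mor C Y Z" "i' \<in> mor C X' Y'" "d' \<in> mor C Y' Z'"
    and iso: "is_iso C X X' a" "is_iso C Y Y' b" "is_iso C Z Z' c"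
    and e: "Comp C X Y Y' b i = Comp C X X' Y' i' a" "Comp C Y Z Z' c d = Comp C Y Y' Z' d' b"
    using assms unfolding pq isomorphic_pairs_def composable_pair_def by auto
  obtain a' where a: "a \<in> mor C X X'" "a' \<in> mor C X' X" "is_iso C X' X a'" "Comp C X X' X a' a = Ident C X"
    "Comp C X' X X' a a' = Ident C X'" by (rule is_isoE[OF iso(1)])
  obtain b' where b: "b \<in> mor C Y Y'" "b' \<in> mor C Y' Y" "is_iso C Y' Y b'" "Comp C Y Y' Y b' b = Ident C Y"
    "Comp C Y' Y Y' b b' = Ident C Y'" by (rule is_isoE[OF iso(2)])
  obtain c' where c: "c \<in> mor C Z Z'" "c' \<in> mor C Z' Z" "is_iso C Z' Z c'" "Comp C Z Z' Z c' c = Ident C Z"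
    "Comp C Z' Z Z' c c' = Ident C Z'" by (rule is_isoE[OF iso(3)])
  have "Comp C X' Y' Y b' i' = Comp C X' Y' Y b' (Comp C X' X Y' (Comp C X X' Y' i' a) a')"
    using ob m a by (simp add: Comp_cancel)
  also have "\<dots> = Comp C X' X Y i a'"
    using ob m a b by (simp add: e(1)[symmetric] Comp_cancel Comp_assoc)
  finally have 1: "Comp C X' Y' Y b' i' = Comp C X' X Y i a'" .
  have "Comp C Y' Y Z d b' = Comp C Y' Z' Z c' (Comp C Y' Y Z' (Comp C Y Z Z' c d) b')"
    using ob m b c by (simp add: Comp_cancel Comp_assoc)
  also have "\<dots> = Comp C Y' Z' Z c' d'"
    using ob m b c by (simp add: e(2) Comp_cancel)
  finally have 2: "Comp C Y' Z' Z c' d' = Comp C Y' Y Z d b'" by simp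
  show ?thesis
    unfolding pq isomorphic_pairs_def composable_pair_def using ob m a b c 1 2 by auto
qed

lemma isomorphic_pairs_trans:
  assumes "isomorphic_pairs C p q" "isomorphic_pairs C q r"
  shows "isomorphic_pairs C p r"
proof -
  obtain X i Y d Z X' i' Y' d' Z' X'' i'' Y'' d'' Z''
    where pq: "p = (X, i, Y, d, Z)" "q = (X', i', Y', d', Z')" "r = (X'', i'', Y'', d'', Z'')"
    by (metis prod.exhaust)
  obtain a b c where ob: "X \<in> Obj C" "Y \<in> Obj C" "Z \<in> Obj C" "X' \<in> Obj C" "Y' \<in> Obj C" "Z' \<in> Obj C"
    and m: "i \<in> mor C X Y" "d \<in> mor C Y Z" "i' \<in> mor C X' Y'" "d' \<in> mor C Y' Z'"
    and iso: "is_iso C X X' a" "is_iso C Y Y' b" "is_iso C Z Z' c"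
    and e: "Comp C X Y Y' b i = Comp C X X' Y' i' a" "Comp C Y Z Z' c d = Comp C Y Y' Z' d' b"
    using assms(1) unfolding pq isomorphic_pairs_def composable_pair_def by auto
  obtain a' b' c' where ob': "X'' \<in> Obj C" "Y'' \<in> Obj C" "Z'' \<in> Obj C"
    and m': "i'' \<in> mor C X'' Y''" "d'' \<in> mor C Y'' Z''"
    and iso': "is_iso C X' X'' a'" "is_iso C Y' Y'' b'" "is_iso C Z' Z'' c'"
    and e': "Comp C X' Y' Y'' b' i' = Comp C X' X'' Y'' i'' a'"
      "Comp C Y' Z' Z'' c' d' = Comp C Y' Y'' Z'' d'' b'"
    using assms(2) unfolding pq isomorphic_pairs_def composable_pair_def by auto
  have ms: "a \<in> mor C X X'" "b \<in> mor C Y Y'" "c \<in> mor C Z Z'"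
    "a' \<in> mor C X' X''" "b' \<in> mor C Y' Y''" "c' \<in> mor C Z' Z''"
    using iso iso' unfolding is_iso_def by auto
  have "Comp C X Y Y'' (Comp C Y Y' Y'' b' b) i = Comp C X X' Y'' (Comp C X' Y' Y'' b' i') a"
    using ob ob' m m' ms e by (simp add: Comp_assoc)
  then have 1: "Comp C X Y Y'' (Comp C Y Y' Y'' b' b) i = Comp C X X'' Y'' i'' (Comp C X X' X'' a' a)"
    using ob ob' m m' ms e' by (simp add: Comp_assoc)
  have "Comp C Y Z Z'' (Comp C Z Z' Z'' c' c) d = Comp C Y Y' Z'' (Comp C Y' Z' Z'' c' d') b"
    using ob ob' m m' ms e by (simp add: Comp_assoc)
  then have 2: "Comp C Y Z Z'' (Comp C Z Z' Z'' c' c) d = Comp C Y Y'' Z'' d'' (Comp C Y Y' Y'' b' b)"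
    using ob ob' m m' ms e' by (simp add: Comp_assoc)
  show ?thesis
    unfolding pq isomorphic_pairs_def composable_pair_def
    using ob ob' m m' 1 2 is_iso_Comp[OF iso(1) iso'(1)] is_iso_Comp[OF iso(2) iso'(2)]
      is_iso_Comp[OF iso(3) iso'(3)] by auto
qed

section \<open>Kernels and pullbacks under isomorphism\<close>

lemma is_kernel_mono:
  assumes "is_kernel C X Y Z i d" "W \<in> Obj C" "g \<in> mor C W X" "h \<in> mor C W X"
    "Comp C W X Y i g = Comp C W X Y i h"
  shows "g = h"
proof -
  have m: "X \<in> Obj C" "Y \<in> Obj C" "Z \<in> Obj C" "i \<in> mor C X Y" "d \<in> mor C Y Z"
    "Comp C X Y Z d i = zero_mor C X Z"
    using assms(1) unfolding is_kernel_def composable_pair_def by auto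
  have "Comp C W Y Z d (Comp C W X Y i g) = zero_mor C W Z"
    using m assms by (simp add: Comp_assoc[symmetric])
  then have "\<exists>!k. k \<in> mor C W X \<and> Comp C W X Y i k = Comp C W X Y i g"
    using assms m unfolding is_kernel_def by simp
  then show ?thesis using assms by metis
qed

text \<open>Write \<open>i'\<close> and \<open>d'\<close> as conjugates of \<open>i\<close> and
  \<open>d\<close> by the given isomorphisms. A map killed by \<open>d'\<close> is moved back along
  \<open>b\<close>, lifted through \<open>i\<close> and moved forward along \<open>a\<close>. This
  is what carries kernels from images of conflations to all of their isomorphic copies.\<close>

lemma is_kernel_isomorphic:
  assumes k: "is_kernel C X Y Z i d"
    and iso: "isomorphic_pairs C (X, i, Y, d, Z) (X', i', Y', d', Z')"
  shows "is_kernel C X' Y' Z' i' d'"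
proof -
  obtain a b c where ob: "X \<in> Obj C" "Y \<in> Obj C" "Z \<in> Obj C" "X' \<in> Obj C" "Y' \<in> Obj C" "Z' \<in> Obj C"
    and m: "i \<in> mor C X Y" "d \<in> mor C Y Z" "i' \<in> mor C X' Y'" "d' \<in> mor C Y' Z'"
    and iso: "is_iso C X X' a" "is_iso C Y Y' b" "is_iso C Z Z' c"
    and e: "Comp C X Y Y' b i = Comp C X X' Y' i' a" "Comp C Y Z Z' c d = Comp C Y Y' Z' d' b"
    using iso unfolding isomorphic_pairs_def composable_pair_def by auto
  obtain a' where a: "a \<in> mor C X X'" "a' \<in> mor C X' X" "is_iso C X' X a'" "Comp C X X' X a' a = Ident C X"
    "Comp C X' X X' a a' = Ident C X'" by (rule is_isoE[OF iso(1)])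
  obtain b' where b: "b \<in> mor C Y Y'" "b' \<in> mor C Y' Y" "is_iso C Y' Y b'" "Comp C Y Y' Y b' b = Ident C Y"
    "Comp C Y' Y Y' b b' = Ident C Y'" by (rule is_isoE[OF iso(2)])
  obtain c' where c: "c \<in> mor C Z Z'" "c' \<in> mor C Z' Z" "is_iso C Z' Z c'" "Comp C Z Z' Z c' c = Ident C Z"
    "Comp C Z' Z Z' c c' = Ident C Z'" by (rule is_isoE[OF iso(3)])
  have di: "Comp C X Y Z d i = zero_mor C X Z" using k unfolding is_kernel_def by auto
  have i': "i' = Comp C X' Y Y' b (Comp C X' X Y i a')"
    using ob m a b by (simp add: Comp_assoc[symmetric] e(1) Comp_cancel)
  have d': "d' = Comp C Y' Y Z' (Comp C Y Z Z' c d) b'"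
    using ob m a b by (simp add: e(2) Comp_cancel)
  have "Comp C X' Y' Z' d' i' = Comp C X' Y Z' (Comp C Y Z Z' c d) (Comp C X' Y' Y b' i')"
    unfolding d' using ob m b c by (simp add: Comp_assoc)
  also have "\<dots> = Comp C X' Y Z' (Comp C Y Z Z' c d) (Comp C X' X Y i a')"
    unfolding i' using ob m a b c by (simp add: Comp_cancel)
  also have "\<dots> = Comp C X' Z Z' c (Comp C X' X Z (Comp C X Y Z d i) a')"
    using ob m a c by (simp add: Comp_assoc)
  finally have z: "Comp C X' Y' Z' d' i' = zero_mor C X' Z'"
    using ob a c di by simp
  show ?thesis
    unfolding is_kernel_def composable_pair_def
  proof (simp add: ob m z, intro ballI impI)
    fix W f assume W: "W \<in> Obj C" and f: "f \<in> mor C W Y'" "Comp C W Y' Z' d' f = zero_mor C W Z'"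
    have "Comp C W Y Z d (Comp C W Y' Y b' f) = Comp C W Z' Z c' (Comp C W Y' Z' d' f)"
      unfolding d' using ob m W f b c by (simp add: Comp_assoc Comp_cancel)
    also have "\<dots> = zero_mor C W Z" using f W ob c by simp
    finally obtain g where g: "g \<in> mor C W X" "Comp C W X Y i g = Comp C W Y' Y b' f"
      using k W f ob b unfolding is_kernel_def by (metis Comp_closed)
    show "\<exists>!g. g \<in> mor C W X' \<and> Comp C W X' Y' i' g = f"
    proof (rule ex1I[of _ "Comp C W X X' a g"], intro conjI)
      show "Comp C W X X' a g \<in> mor C W X'" using ob W a g by simp
      show "Comp C W X' Y' i' (Comp C W X X' a g) = f"
        unfolding i' using ob W a g b m f by (simp add: Comp_assoc Comp_cancel)
      fix h assume h: "h \<in> mor C W X' \<and> Comp C W X' Y' i' h = f"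
      then have "Comp C W X Y i g = Comp C W X Y i (Comp C W X' X a' h)"
        unfolding g(2) i' using ob W a b m by (auto simp: Comp_assoc Comp_cancel)
      then have "g = Comp C W X' X a' h"
        using is_kernel_mono[OF k W g(1)] h a ob W by simp
      then show "h = Comp C W X X' a g"
        using h a ob W by (simp add: Comp_cancel)
    qed
  qed
qed

lemma is_pullback_unique:
  assumes "is_pullback C X Y Z f g V u v" "W \<in> Obj C" "w \<in> mor C W V" "w' \<in> mor C W V"
    "Comp C W V X u w = Comp C W V X u w'" "Comp C W V Y v w = Comp C W V Y v w'"
  shows "w = w'"
proof -
  have m: "X \<in> Obj C" "Y \<in> Obj C" "Z \<in> Obj C" "V \<in> Obj C" "f \<in> mor C X Z" "g \<in> mor C Y Z"
    "u \<in> mor C V X" "v \<in> mor C V Y" "Comp C V X Z f u = Comp C V Y Z g v"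
    using assms(1) unfolding is_pullback_def by auto
  have "Comp C W X Z f (Comp C W V X u w) = Comp C W Y Z g (Comp C W V Y v w)"
    using m assms(2,3) by (simp add: Comp_assoc[symmetric])
  then have "\<exists>!k. k \<in> mor C W V \<and> Comp C W V X u k = Comp C W V X u w
      \<and> Comp C W V Y v k = Comp C W V Y v w"
    using assms(1-3) m unfolding is_pullback_def by simp
  then show ?thesis using assms by metis
qed

text \<open>The inverse of \<open>f\<close> after \<open>g\<close>, together with the identity of
  \<open>Y\<close>, is a cone; the map it induces is a section of \<open>v\<close>, and the
  uniqueness in the universal property makes it a two-sided inverse.\<close>

lemma is_pullback_iso:
  assumes pb: "is_pullback C X Y Z f g V u v" and f: "is_iso C X Z f"
  shows "is_iso C V Y v"
proof -
  have ob: "X \<in> Obj C" "Y \<in> Obj C" "Z \<in> Obj C" "V \<in> Obj C"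
    and m: "g \<in> mor C Y Z" "u \<in> mor C V X" "v \<in> mor C V Y"
    and e: "Comp C V X Z f u = Comp C V Y Z g v"
    and univ: "\<And>W s t. \<lbrakk>W \<in> Obj C; s \<in> mor C W X; t \<in> mor C W Y; Comp C W X Z f s = Comp C W Y Z g t\<rbrakk>
      \<Longrightarrow> \<exists>!w. w \<in> mor C W V \<and> Comp C W V X u w = s \<and> Comp C W V Y v w = t"
    using pb unfolding is_pullback_def by auto
  obtain f' where f: "f \<in> mor C X Z" "f' \<in> mor C Z X" "is_iso C Z X f'" "Comp C X Z X f' f = Ident C X"
    "Comp C Z X Z f f' = Ident C Z" by (rule is_isoE[OF f])
  obtain w where w: "w \<in> mor C Y V" "Comp C Y V X u w = Comp C Y Z X f' g" "Comp C Y V Y v w = Ident C Y"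
    using univ[of Y "Comp C Y Z X f' g" "Ident C Y"] ob m f by (auto simp: Comp_cancel)
  have "Comp C V V X u (Comp C V Y V w v) = Comp C V Z X f' (Comp C V Y Z g v)"
    using ob m f w by (simp add: Comp_assoc[symmetric])
  also have "\<dots> = u" using ob m f by (simp add: e[symmetric] Comp_cancel)
  finally have 1: "Comp C V V X u (Comp C V Y V w v) = u" .
  have 2: "Comp C V V Y v (Comp C V Y V w v) = v"
    using ob m w by (simp add: Comp_cancel)
  have "Comp C V Y V w v = Ident C V"
    using univ[of V u v] 1 2 ob m w e by (metis Comp_Ident_right Comp_closed Ident_closed)
  then show ?thesis unfolding is_iso_def using m w by auto
qed

text \<open>Since \<open>c\<close> is monic and \<open>b\<close> invertible, cones over the new
  cospan correspond to cones over the old one. The apex and \<open>u\<close> are kept, which matters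
  because \<open>u\<close> is the map that has to remain a deflation.\<close>

lemma is_pullback_transport:
  assumes pb: "is_pullback C X Y Z f g V u v" and ob': "Y' \<in> Obj C" "Z' \<in> Obj C"
    and b: "is_iso C Y Y' b" and c: "is_iso C Z Z' c"
    and f': "f' \<in> mor C X Z'" and fe: "f' = Comp C X Z Z' c f"
    and g': "g' \<in> mor C Y' Z'" and ge: "Comp C Y Y' Z' g' b = Comp C Y Z Z' c g"
  shows "is_pullback C X Y' Z' f' g' V u (Comp C V Y Y' b v)"
proof -
  have ob: "X \<in> Obj C" "Y \<in> Obj C" "Z \<in> Obj C" "V \<in> Obj C"
    and m: "f \<in> mor C X Z" "g \<in> mor C Y Z" "u \<in> mor C V X" "v \<in> mor C V Y"
    and e: "Comp C V X Z f u = Comp C V Y Z g v"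
    and univ: "\<And>W s t. \<lbrakk>W \<in> Obj C; s \<in> mor C W X; t \<in> mor C W Y; Comp C W X Z f s = Comp C W Y Z g t\<rbrakk>
      \<Longrightarrow> \<exists>!w. w \<in> mor C W V \<and> Comp C W V X u w = s \<and> Comp C W V Y v w = t"
    using pb unfolding is_pullback_def by auto
  obtain b' where b: "b \<in> mor C Y Y'" "b' \<in> mor C Y' Y" "is_iso C Y' Y b'" "Comp C Y Y' Y b' b = Ident C Y"
    "Comp C Y' Y Y' b b' = Ident C Y'" by (rule is_isoE[OF b])
  obtain c' where c: "c \<in> mor C Z Z'" "c' \<in> mor C Z' Z" "is_iso C Z' Z c'" "Comp C Z Z' Z c' c = Ident C Z"
    "Comp C Z' Z Z' c c' = Ident C Z'" by (rule is_isoE[OF c])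
  have ge': "Comp C Y' Y Z g b' = Comp C Y' Z' Z c' g'"
  proof -
    have "Comp C Y' Y Z g b' = Comp C Y' Z' Z c' (Comp C Y' Y Z' (Comp C Y Z Z' c g) b')"
      using ob ob' m b c by (simp add: Comp_assoc Comp_cancel)
    then show ?thesis using ob ob' m b c g' by (simp add: ge[symmetric] Comp_cancel)
  qed
  have sq: "Comp C V X Z' f' u = Comp C V Y' Z' g' (Comp C V Y Y' b v)"
    using ob ob' m b c g' e unfolding fe by (simp add: Comp_assoc[symmetric] ge) (simp add: Comp_assoc)
  show ?thesis
    unfolding is_pullback_def
  proof (simp add: ob ob' m b f' g' sq, intro ballI impI)
    fix W s t assume W: "W \<in> Obj C" and s: "s \<in> mor C W X" and t: "t \<in> mor C W Y'"
      and st: "Comp C W X Z' f' s = Comp C W Y' Z' g' t"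
    have "Comp C W X Z f s = Comp C W Z' Z c' (Comp C W X Z' f' s)"
      unfolding fe using ob ob' m c W s by (simp add: Comp_assoc Comp_cancel)
    also have "\<dots> = Comp C W Y Z g (Comp C W Y' Y b' t)"
      unfolding st using ob ob' m b c g' W t by (simp add: Comp_assoc[symmetric] ge')
    finally have "\<exists>!w. w \<in> mor C W V \<and> Comp C W V X u w = s \<and> Comp C W V Y v w = Comp C W Y' Y b' t"
      using univ W s t b ob ob' by simp
    moreover have "Comp C W V Y v w = Comp C W Y' Y b' t \<longleftrightarrow> Comp C W V Y' (Comp C V Y Y' b v) w = t"
      if "w \<in> mor C W V" for w
    proof
      assume "Comp C W V Y v w = Comp C W Y' Y b' t"
      then show "Comp C W V Y' (Comp C V Y Y' b v) w = t"
        using ob ob' m b W t that by (simp add: Comp_assoc Comp_cancel)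
    next
      assume "Comp C W V Y' (Comp C V Y Y' b v) w = t"
      then have "Comp C W Y' Y b' t = Comp C W Y' Y b' (Comp C W V Y' (Comp C V Y Y' b v) w)" by simp
      then show "Comp C W V Y v w = Comp C W Y' Y b' t"
        using ob ob' m b W t that by (simp add: Comp_assoc Comp_cancel)
    qed
    ultimately show "\<exists>!w. w \<in> mor C W V \<and> Comp C W V X u w = s \<and> Comp C W V Y' (Comp C V Y Y' b v) w = t"
      by (smt (verit))
  qed
qed

section \<open>Projectivity as a lifting property\<close>

lemma short_exact_sequence_Hom_iff:
  assumes k: "is_kernel C X Y Z i d" and P: "P \<in> Obj C"
  shows "short_exact_sequence (Hom C P Z) (Hom C P Y) (Hom C P X) (Comp C P Y Z d) (Comp C P X Y i)
    \<longleftrightarrow> (\<forall>g \<in> mor C P Z. \<exists>h \<in> mor C P Y. Comp C P Y Z d h = g)"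
proof -
  have m: "X \<in> Obj C" "Y \<in> Obj C" "Z \<in> Obj C" "i \<in> mor C X Y" "d \<in> mor C Y Z"
    "Comp C X Y Z d i = zero_mor C X Z"
    using k unfolding is_kernel_def composable_pair_def by auto
  note hi = postcomp_hom[OF P m(1,2,4)] and hd = postcomp_hom[OF P m(2,3,5)]
  \<comment> \<open>Left exactness: the universal property of the kernel \<open>i\<close> gives
    exactness in the middle and injectivity on the left, so only surjectivity on the right remains
    as a condition.\<close>
  have "kernel (Hom C P Y) (Hom C P Z) (Comp C P Y Z d) = Comp C P X Y i ` mor C P X"
  proof (intro equalityI subsetI)
    fix f assume "f \<in> kernel (Hom C P Y) (Hom C P Z) (Comp C P Y Z d)"
    then have "\<exists>!g. g \<in> mor C P X \<and> Comp C P X Y i g = f"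
      using k P unfolding is_kernel_def kernel_def by simp
    then show "f \<in> Comp C P X Y i ` mor C P X" by blast
  qed (use m P in \<open>auto simp: kernel_def Comp_assoc[symmetric]\<close>)
  moreover have "inj_on (Comp C P X Y i) (mor C P X)"
    using is_kernel_mono[OF k P] by (auto intro: inj_onI)
  ultimately have "short_exact_sequence (Hom C P Z) (Hom C P Y) (Hom C P X) (Comp C P Y Z d) (Comp C P X Y i)
      \<longleftrightarrow> Comp C P Y Z d ` mor C P Y = mor C P Z"
    using hi hd unfolding short_exact_sequence_iff
    by (simp add: epi_def mon_def group_hom.homh exact_seq_end_iff group_hom.axioms(2))
  also have "\<dots> \<longleftrightarrow> (\<forall>g \<in> mor C P Z. \<exists>h \<in> mor C P Y. Comp C P Y Z d h = g)"
    using m P by (auto simp: image_iff set_eq_iff) metis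
  finally show ?thesis .
qed

text \<open>The class \<open>E\<close> is only asked to consist of kernels. The criterion therefore
  applies to the conflations of the quotient before they are known to form an exact
  structure.\<close>

lemma projective_object_iff:
  assumes "\<And>X i Y d Z. (X, i, Y, d, Z) \<in> E \<Longrightarrow> is_kernel C X Y Z i d"
  shows "projective_object C E P \<longleftrightarrow> P \<in> Obj C \<and>
    (\<forall>Y Z d. deflation E Y Z d \<longrightarrow> (\<forall>g \<in> mor C P Z. \<exists>h \<in> mor C P Y. Comp C P Y Z d h = g))"
  using short_exact_sequence_Hom_iff[OF assms] unfolding projective_object_def deflation_def by blast

end

section \<open>Duality\<close>

definition op_cat :: "('o, 'm) precat \<Rightarrow> ('o, 'm) precat" where
  "op_cat C = \<lparr>Obj = Obj C, Hom = (\<lambda>X Y. Hom C Y X), Comp = (\<lambda>X Y Z g f. Comp C Z Y X f g),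
    Ident = Ident C\<rparr>"

definition op_pairs :: "('o, 'm) pair set \<Rightarrow> ('o, 'm) pair set" where
  "op_pairs E = {(Z, d, Y, i, X) | Z d Y i X. (X, i, Y, d, Z) \<in> E}"

lemma op_cat_simps [simp]:
  "Obj (op_cat C) = Obj C" "Hom (op_cat C) X Y = Hom C Y X"
  "Comp (op_cat C) X Y Z g f = Comp C Z Y X f g" "Ident (op_cat C) X = Ident C X"
  by (simp_all add: op_cat_def)

text \<open>An equality rather than an equivalence, because the Hom groups are reused unchanged; a
  dual statement can hence be obtained by instantiating the original at
  \<open>op_cat C\<close>.\<close>

lemma op_cat_op_cat [simp]: "op_cat (op_cat C) = C"
  by (simp add: op_cat_def)

lemma op_pairs_iff [simp]: "(Z, d, Y, i, X) \<in> op_pairs E \<longleftrightarrow> (X, i, Y, d, Z) \<in> E"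
  by (simp add: op_pairs_def)

lemma op_pairs_op_pairs [simp]: "op_pairs (op_pairs E) = E"
  by auto

lemma inflation_op [simp]: "inflation (op_pairs E) X Y i \<longleftrightarrow> deflation E Y X i"
  and deflation_op [simp]: "deflation (op_pairs E) X Y i \<longleftrightarrow> inflation E Y X i"
  by (auto simp: inflation_def deflation_def)

lemma is_iso_op [simp]: "is_iso (op_cat C) X Y f \<longleftrightarrow> is_iso C Y X f"
  unfolding is_iso_def by auto

lemma composable_pair_op:
  "composable_pair (op_cat C) (Z, d, Y, i, X) \<longleftrightarrow> composable_pair C (X, i, Y, d, Z)"
  unfolding composable_pair_def by auto

lemma is_kernel_op [simp]: "is_kernel (op_cat C) Z Y X d i \<longleftrightarrow> is_cokernel C X Y Z i d"
  and is_cokernel_op [simp]: "is_cokernel (op_cat C) Z Y X d i \<longleftrightarrow> is_kernel C X Y Z i d"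
  unfolding is_kernel_def is_cokernel_def composable_pair_def by auto

lemma is_pullback_op [simp]: "is_pullback (op_cat C) X Y Z f g V u v \<longleftrightarrow> is_pushout C X Y Z f g V u v"
  and is_pushout_op [simp]: "is_pushout (op_cat C) X Y Z f g V u v \<longleftrightarrow> is_pullback C X Y Z f g V u v"
  unfolding is_pullback_def is_pushout_def by simp_all

text \<open>The sides are exchanged because reversing arrows turns isomorphisms from the first pair
  to the second into isomorphisms the other way. \<open>isomorphic_pairs_sym\<close> restores the
  order when needed.\<close>

lemma isomorphic_pairs_op:
  "isomorphic_pairs (op_cat C) (Z, d, Y, i, X) (Z', d', Y', i', X') \<longleftrightarrow>
    isomorphic_pairs C (X', i', Y', d', Z') (X, i, Y, d, Z)"
  unfolding isomorphic_pairs_def by (simp add: composable_pair_op) metis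

lemma zero_object_op [simp]: "zero_object (op_cat C) Z \<longleftrightarrow> zero_object C Z"
  unfolding zero_object_def by auto

lemma biproduct_op: "biproduct (op_cat C) X Y S i j p q \<longleftrightarrow> biproduct C X Y S p q i j"
  unfolding biproduct_def by auto

lemma projective_object_op [simp]: "projective_object (op_cat C) (op_pairs E) P \<longleftrightarrow> injective_object C E P"
  unfolding projective_object_def injective_object_def op_cat_def by auto

lemma injective_object_op [simp]: "injective_object (op_cat C) (op_pairs E) P \<longleftrightarrow> projective_object C E P"
  using projective_object_op[of "op_cat C" "op_pairs E"] by simp

lemma enough_projectives_op [simp]: "enough_projectives (op_cat C) (op_pairs E) \<longleftrightarrow> enough_injectives C E"
  and enough_injectives_op [simp]: "enough_injectives (op_cat C) (op_pairs E) \<longleftrightarrow> enough_projectives C E"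
  unfolding enough_projectives_def enough_injectives_def by simp_all

lemma left_approximation_op [simp]: "left_approximation (op_cat C) F X FX f \<longleftrightarrow> right_approximation C F X FX f"
  and right_approximation_op [simp]: "right_approximation (op_cat C) F X FX f \<longleftrightarrow> left_approximation C F X FX f"
  unfolding left_approximation_def right_approximation_def by simp_all

lemma pseudo_cokernel_op [simp]: "pseudo_cokernel (op_cat C) X Y Z f c \<longleftrightarrow> pseudo_kernel C Z Y X c f"
  and pseudo_kernel_op [simp]: "pseudo_kernel (op_cat C) X Y Z f c \<longleftrightarrow> pseudo_cokernel C Z Y X c f"
  unfolding pseudo_cokernel_def pseudo_kernel_def composable_pair_def by auto

section \<open>Opposites of additive, exact and Frobenius categories\<close>

lemma preadditive_category_op: "preadditive_category C \<Longrightarrow> preadditive_category (op_cat C)"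
  unfolding preadditive_category_def by simp

lemma additive_category_op:
  assumes "additive_category C" shows "additive_category (op_cat C)"
proof -
  interpret additive_category C by fact
  show ?thesis
    by (intro additive_category.intro preadditive_category_op preadditive_category_axioms
        additive_category_axioms.intro)
      (use zero_object_exists biproduct_exists in \<open>simp_all add: biproduct_op, blast\<close>)
qed

text \<open>The axioms are visibly self-dual except for the one on the zero object, which speaks of
  a deflation only. There the kernel of the identity of \<open>Z\<close> is shown to be an
  isomorphism onto \<open>Z\<close>, so the conflation is isomorphic to the one with two identities,
  and the identity is an inflation too.\<close>

lemma exact_category_op:
  assumes "exact_category C E" shows "exact_category (op_cat C) (op_pairs E)"
proof -
  interpret exact_category C E by fact
  show ?thesis
  proof (intro exact_category.intro exact_category_axioms.intro)
    show "additive_category (op_cat C)" using additive_category_op additive_category_axioms .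
    show "kernel_cokernel_pair (op_cat C) c" if "c \<in> op_pairs E" for c
    proof (cases c)
      case (fields Z d Y i X)
      then show ?thesis using that conflation_kernel_cokernel[of "(X, i, Y, d, Z)"]
        by (simp add: kernel_cokernel_pair_def)
    qed
    show "c' \<in> op_pairs E" if "c \<in> op_pairs E" "isomorphic_pairs (op_cat C) c c'" for c c'
    proof (cases c; cases c')
      fix Z d Y i X Z' d' Y' i' X'
      assume [simp]: "c = (Z, d, Y, i, X)" "c' = (Z', d', Y', i', X')"
      have "isomorphic_pairs C (X, i, Y, d, Z) (X', i', Y', d', Z')"
        using that isomorphic_pairs_sym by (simp add: isomorphic_pairs_op)
      then show ?thesis using that conflation_iso_closed by simp
    qed
    show "deflation (op_pairs E) Z Z (Ident (op_cat C) Z)" if z: "zero_object (op_cat C) Z" for Z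
    proof -
      have z: "zero_object C Z" and Z: "Z \<in> Obj C" using z by (auto simp: zero_object_def)
      then obtain X i where c: "(X, i, Z, Ident C Z, Z) \<in> E"
        using zero_deflation unfolding deflation_def by blast
      then have k: "is_kernel C X Z Z i (Ident C Z)"
        using conflation_kernel_cokernel by (auto simp: kernel_cokernel_pair_def)
      then have X: "X \<in> Obj C" "i \<in> mor C X Z" by (auto simp: is_kernel_def composable_pair_def)
      have "zero_mor C Z X \<in> mor C Z X" using X Z by simp
      \<comment> \<open>The kernel \<open>i\<close> is monic and all maps from \<open>X\<close> to
        the zero object \<open>Z\<close> agree, so the zero map is a left inverse of
        \<open>i\<close>.\<close>
      moreover have "Comp C X Z X (zero_mor C Z X) i = Ident C X"
      proof (rule is_kernel_mono[OF k X(1)])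
        show "Comp C X X Z i (Comp C X Z X (zero_mor C Z X) i) = Comp C X X Z i (Ident C X)"
          using zero_object_mor_eq(1)[OF z X(1)] X Z by simp
      qed (use X Z in simp_all)
      moreover have "Comp C Z X Z i (zero_mor C Z X) = Ident C Z"
        using zero_object_mor_eq(1)[OF z Z] X Z by simp
      ultimately have "is_iso C X Z i" using X unfolding is_iso_def by blast
      then have "isomorphic_pairs C (X, i, Z, Ident C Z, Z) (Z, Ident C Z, Z, Ident C Z, Z)"
        unfolding isomorphic_pairs_def composable_pair_def prod.case
        using X Z is_iso_Ident[OF Z]
        by (intro conjI exI[of _ i] exI[of _ "Ident C Z"]) simp_all
      then have "(Z, Ident C Z, Z, Ident C Z, Z) \<in> E" using conflation_iso_closed c by blast
      then show ?thesis by (auto simp: inflation_def)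
    qed
  qed (use inflation_Comp deflation_Comp inflation_pushout deflation_pullback in simp_all)
qed

lemma frobenius_category_op:
  assumes "frobenius_category C E" shows "frobenius_category (op_cat C) (op_pairs E)"
proof -
  interpret frobenius_category C E by fact
  show ?thesis
    by (intro frobenius_category.intro frobenius_category_axioms.intro exact_category_op
        exact_category_axioms)
      (simp_all add: enough_projectives enough_injectives projective_iff_injective)
qed

context exact_category
begin

section \<open>Conflations, lifting and extension in an exact category\<close>

lemma conflation_kernel: "(X, i, Y, d, Z) \<in> E \<Longrightarrow> is_kernel C X Y Z i d"
  and conflation_cokernel: "(X, i, Y, d, Z) \<in> E \<Longrightarrow> is_cokernel C X Y Z i d"
  using conflation_kernel_cokernel by (fastforce simp: kernel_cokernel_pair_def)+

lemma conflation_composable: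
  assumes "(X, i, Y, d, Z) \<in> E"
  shows "X \<in> Obj C" "Y \<in> Obj C" "Z \<in> Obj C" "i \<in> mor C X Y" "d \<in> mor C Y Z"
    "Comp C X Y Z d i = zero_mor C X Z"
  using conflation_kernel[OF assms] by (simp_all add: is_kernel_def composable_pair_def)

lemma deflation_mor: "deflation E Y Z d \<Longrightarrow> Y \<in> Obj C \<and> Z \<in> Obj C \<and> d \<in> mor C Y Z"
  unfolding deflation_def by (blast dest: conflation_composable(2,3,5))

lemma projective_lift:
  assumes "projective_object C E P" "deflation E Y Z d" "g \<in> mor C P Z"
  shows "\<exists>h \<in> mor C P Y. Comp C P Y Z d h = g"
  using assms projective_object_iff[OF conflation_kernel, of E P] by blast

lemma injective_extend:
  assumes "injective_object C E I" "inflation E X Y i" "g \<in> mor C X I"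
  shows "\<exists>h \<in> mor C Y I. Comp C X Y I h i = g"
proof -
  interpret op: exact_category "op_cat C" "op_pairs E"
    by (rule exact_category_op[OF exact_category_axioms])
  show ?thesis using op.projective_lift[of I Y X i g] assms by simp
qed

end


section \<open>The factor category\<close>

text \<open>Preadditivity of \<open>C\<close> suffices here: the zero object and the biproducts that
  make the factoring morphisms a subgroup are supplied by \<open>F\<close>.\<close>

locale factor_by_subcategory = preadditive_category C for C :: "('o, 'm) precat" +
  fixes F :: "'o set"
  assumes F_full_additive: "full_additive_subcategory C F"
begin

abbreviation Q :: "('o, 'm set) precat" where "Q \<equiv> factor_category C F"
abbreviation \<pi> :: "'o \<Rightarrow> 'o \<Rightarrow> 'm \<Rightarrow> 'm set" where "\<pi> \<equiv> factor_mor C F"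
abbreviation ideal :: "'o \<Rightarrow> 'o \<Rightarrow> 'm set" where "ideal \<equiv> factoring_mors C F"

lemma F_Obj: "W \<in> F \<Longrightarrow> W \<in> Obj C"
  using F_full_additive unfolding full_additive_subcategory_def by auto

text \<open>Being zero in the full subcategory concerns maps to and from objects of \<open>F\<close>
  only, but it forces the identity to vanish, and this is a condition on one Hom group shared with
  \<open>C\<close>.\<close>

lemma F_zero_object: "\<exists>Z \<in> F. zero_object C Z"
proof -
  interpret full: additive_category "full_subcategory C F"
    using F_full_additive unfolding full_additive_subcategory_def by simp
  obtain Z where Z: "zero_object (full_subcategory C F) Z" using full.zero_object_exists by blast
  then have ZF: "Z \<in> F" by (simp add: zero_object_def full_subcategory_def)
  then have "Ident C Z = zero_mor C Z Z"
    using full.zero_object_mor_eq(1)[OF Z, of Z "Ident C Z" "zero_mor C Z Z"] F_Obj[OF ZF]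
    by (simp add: full_subcategory_def)
  then show ?thesis using ZF F_Obj zero_objectI by blast
qed

text \<open>Biproducts are defined by equations between their structure maps, so those of the full
  subcategory remain biproducts in \<open>C\<close>.\<close>

lemma F_biproduct:
  assumes "V \<in> F" "W \<in> F"
  shows "\<exists>S i j p q. S \<in> F \<and> biproduct C V W S i j p q"
proof -
  interpret full: additive_category "full_subcategory C F"
    using F_full_additive unfolding full_additive_subcategory_def by simp
  obtain S i j p q where "biproduct (full_subcategory C F) V W S i j p q"
    using full.biproduct_exists[of V W] assms by (auto simp: full_subcategory_def)
  then have "S \<in> F" "biproduct C V W S i j p q"
    using F_Obj by (auto simp: biproduct_def full_subcategory_def)
  then show ?thesis by blast
qed

section \<open>The ideal of morphisms factoring through \<open>F\<close>\<close>

lemma factoring_morsI: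
  assumes "W \<in> F" "X \<in> Obj C" "Y \<in> Obj C" "g \<in> mor C X W" "h \<in> mor C W Y"
  shows "Comp C X W Y h g \<in> ideal X Y"
  using assms F_Obj unfolding factoring_mors_def by auto

lemma factoring_morsE:
  assumes "f \<in> ideal X Y"
  obtains W g h where "W \<in> F" "W \<in> Obj C" "g \<in> mor C X W" "h \<in> mor C W Y" "f = Comp C X W Y h g"
  using assms F_Obj unfolding factoring_mors_def by auto

lemma factoring_mors_mor: "f \<in> ideal X Y \<Longrightarrow> f \<in> mor C X Y"
  unfolding factoring_mors_def by auto

text \<open>A sum of two factoring morphisms factors through the biproduct of the two intermediate
  objects; a negative is absorbed into the second factor, and the zero map factors through any
  object of \<open>F\<close>.\<close>

lemma subgroup_factoring_mors:
  assumes X: "X \<in> Obj C" and Y: "Y \<in> Obj C"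
  shows "subgroup (ideal X Y) (Hom C X Y)"
proof
  show "ideal X Y \<subseteq> mor C X Y" using factoring_mors_mor by blast
next
  fix f f' assume "f \<in> ideal X Y" "f' \<in> ideal X Y"
  obtain W g h where W: "W \<in> F" "W \<in> Obj C" "g \<in> mor C X W" "h \<in> mor C W Y"
    and f: "f = Comp C X W Y h g"
    using \<open>f \<in> ideal X Y\<close> by (rule factoring_morsE)
  obtain W' g' h' where W': "W' \<in> F" "W' \<in> Obj C" "g' \<in> mor C X W'" "h' \<in> mor C W' Y"
    and f': "f' = Comp C X W' Y h' g'"
    using \<open>f' \<in> ideal X Y\<close> by (rule factoring_morsE)
  obtain S i j p q where S: "S \<in> F" and "biproduct C W W' S i j p q"
    using F_biproduct[OF W(1) W'(1)] by blast
  then have m: "S \<in> Obj C" "i \<in> mor C W S" "j \<in> mor C W' S" "p \<in> mor C S W" "q \<in> mor C S W'"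
    and e: "Comp C W S W p i = Ident C W" "Comp C W' S W' q j = Ident C W'"
      "Comp C W' S W p j = zero_mor C W' W" "Comp C W S W' q i = zero_mor C W W'"
    unfolding biproduct_def by auto
  \<comment> \<open>\<open>u\<close> is the column with entries \<open>g\<close>, \<open>g'\<close>
    and \<open>v\<close> the row with entries \<open>h\<close>, \<open>h'\<close>, so that
    \<open>v\<close> after \<open>u\<close> is the sum.\<close>
  define u where "u = Comp C X W S i g \<otimes>\<^bsub>Hom C X S\<^esub> Comp C X W' S j g'"
  define v where "v = Comp C S W Y h p \<otimes>\<^bsub>Hom C S Y\<^esub> Comp C S W' Y h' q"
  have uv: "u \<in> mor C X S" "v \<in> mor C S Y" unfolding u_def v_def using X Y W W' m by simp_all
  have "Comp C X S W p u = g"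
    unfolding u_def using X W W' m e Hom_group[OF X W(2)]
    by (simp add: Comp_add_right Comp_assoc[symmetric] group.is_monoid)
  moreover have "Comp C X S W' q u = g'"
    unfolding u_def using X W W' m e Hom_group[OF X W'(2)]
    by (simp add: Comp_add_right Comp_assoc[symmetric] group.is_monoid)
  ultimately have "f \<otimes>\<^bsub>Hom C X Y\<^esub> f' = Comp C X S Y v u"
    unfolding v_def f f' using X Y W W' m uv by (simp add: Comp_add_left Comp_assoc)
  then show "f \<otimes>\<^bsub>Hom C X Y\<^esub> f' \<in> ideal X Y"
    using factoring_morsI[OF S X Y uv] by simp
next
  obtain Z where Z: "Z \<in> F" using F_zero_object by blast
  then show "zero_mor C X Y \<in> ideal X Y"
    using factoring_morsI[OF Z X Y, of "zero_mor C X Z" "zero_mor C Z Y"] X Y F_Obj by simp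
next
  fix f assume "f \<in> ideal X Y"
  then obtain W g h where W: "W \<in> F" "W \<in> Obj C" "g \<in> mor C X W" "h \<in> mor C W Y"
    and f: "f = Comp C X W Y h g"
    by (rule factoring_morsE)
  show "inv\<^bsub>Hom C X Y\<^esub> f \<in> ideal X Y"
    using factoring_morsI[OF W(1) X Y W(3), of "inv\<^bsub>Hom C W Y\<^esub> h"] X Y W
    by (simp add: f Comp_minus_left)
qed

lemma normal_factoring_mors: "X \<in> Obj C \<Longrightarrow> Y \<in> Obj C \<Longrightarrow> ideal X Y \<lhd> Hom C X Y"
  using comm_group.normal_iff_subgroup[OF Hom_comm_group] subgroup_factoring_mors by blast

lemma factoring_mors_Comp_left:
  assumes "X \<in> Obj C" "Y \<in> Obj C" "Z \<in> Obj C" "f \<in> ideal X Y" "g \<in> mor C Y Z"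
  shows "Comp C X Y Z g f \<in> ideal X Z"
  using assms(4)
proof (rule factoring_morsE)
  fix W k h assume "W \<in> F" "W \<in> Obj C" "k \<in> mor C X W" "h \<in> mor C W Y" "f = Comp C X W Y h k"
  then show ?thesis
    using factoring_morsI[of W X Z k "Comp C W Y Z g h"] assms by (simp add: Comp_assoc)
qed

lemma factoring_mors_Comp_right:
  assumes "X \<in> Obj C" "Y \<in> Obj C" "Z \<in> Obj C" "f \<in> mor C X Y" "g \<in> ideal Y Z"
  shows "Comp C X Y Z g f \<in> ideal X Z"
  using assms(5)
proof (rule factoring_morsE)
  fix W k h assume "W \<in> F" "W \<in> Obj C" "k \<in> mor C Y W" "h \<in> mor C W Z" "g = Comp C Y W Z h k"
  then show ?thesis
    using factoring_morsI[of W X Z "Comp C X Y W k f" h] assms by (simp add: Comp_assoc)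
qed

section \<open>The canonical functor and the structure of the quotient\<close>

lemma Obj_Q [simp]: "Obj Q = Obj C"
  and Hom_Q: "Hom Q X Y = Hom C X Y Mod ideal X Y"
  and Ident_Q: "Ident Q X = \<pi> X X (Ident C X)"
  by (simp_all add: factor_category_def)

lemma \<pi>_closed [simp]: "f \<in> mor C X Y \<Longrightarrow> \<pi> X Y f \<in> mor Q X Y"
  by (auto simp: Hom_Q carrier_FactGroup factor_mor_def)

lemma \<pi>_surj: "G \<in> mor Q X Y \<Longrightarrow> \<exists>f \<in> mor C X Y. G = \<pi> X Y f"
  by (auto simp: Hom_Q carrier_FactGroup factor_mor_def)

lemma \<pi>_eqI:
  assumes "X \<in> Obj C" "Y \<in> Obj C" "f \<in> mor C X Y" "g \<in> mor C X Y" "diff_mor C X Y f g \<in> ideal X Y"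
  shows "\<pi> X Y f = \<pi> X Y g"
proof -
  note group = Hom_group[OF assms(1,2)] and subgroup = subgroup_factoring_mors[OF assms(1,2)]
  have "f \<in> \<pi> X Y g"
    unfolding factor_mor_def using subgroup.rcos_module_rev[OF subgroup group] assms by blast
  then show ?thesis
    using group.repr_independence[OF group _ assms(4) subgroup] unfolding factor_mor_def by simp
qed

lemma \<pi>_eqD:
  assumes "X \<in> Obj C" "Y \<in> Obj C" "f \<in> mor C X Y" "g \<in> mor C X Y" "\<pi> X Y f = \<pi> X Y g"
  shows "diff_mor C X Y f g \<in> ideal X Y"
proof -
  note group = Hom_group[OF assms(1,2)] and subgroup = subgroup_factoring_mors[OF assms(1,2)]
  have "f \<in> \<pi> X Y g"
    using group.rcos_self[OF group assms(3) subgroup] assms(5) unfolding factor_mor_def by simp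
  then show ?thesis
    using subgroup.rcos_module_imp[OF subgroup group assms(4)] unfolding factor_mor_def by blast
qed

lemma \<pi>_eq_iff:
  assumes "X \<in> Obj C" "Y \<in> Obj C" "f \<in> mor C X Y" "g \<in> mor C X Y"
  shows "\<pi> X Y f = \<pi> X Y g \<longleftrightarrow> diff_mor C X Y f g \<in> ideal X Y"
  using \<pi>_eqI[OF assms] \<pi>_eqD[OF assms] by blast

lemma \<pi>_add:
  assumes "X \<in> Obj C" "Y \<in> Obj C" "f \<in> mor C X Y" "g \<in> mor C X Y"
  shows "\<pi> X Y f \<otimes>\<^bsub>Hom Q X Y\<^esub> \<pi> X Y g = \<pi> X Y (f \<otimes>\<^bsub>Hom C X Y\<^esub> g)"
  using normal.rcos_sum[OF normal_factoring_mors] assms by (simp add: Hom_Q factor_mor_def)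

lemma \<pi>_eq_zero_iff:
  assumes "X \<in> Obj C" "Y \<in> Obj C" "f \<in> mor C X Y"
  shows "\<pi> X Y f = zero_mor Q X Y \<longleftrightarrow> f \<in> ideal X Y"
  using group.coset_join1[OF Hom_group[OF assms(1,2)] _ assms(3) subgroup_factoring_mors[OF assms(1,2)]]
    group.coset_join2[OF Hom_group[OF assms(1,2)] assms(3) subgroup_factoring_mors[OF assms(1,2)]]
  unfolding Hom_Q factor_mor_def one_FactGroup by blast

lemma \<pi>_zero: "X \<in> Obj C \<Longrightarrow> Y \<in> Obj C \<Longrightarrow> \<pi> X Y (zero_mor C X Y) = zero_mor Q X Y"
  using \<pi>_eq_zero_iff subgroup.one_closed[OF subgroup_factoring_mors] by simp

text \<open>The ideal is two-sided, so changing either representative changes the composite by an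
  element of the ideal, and the union defining the composite of cosets collapses to a single
  coset.\<close>

lemma Comp_Q [simp]:
  assumes "X \<in> Obj C" "Y \<in> Obj C" "Z \<in> Obj C" and f: "f \<in> mor C X Y" and g: "g \<in> mor C Y Z"
  shows "Comp Q X Y Z (\<pi> Y Z g) (\<pi> X Y f) = \<pi> X Z (Comp C X Y Z g f)"
proof -
  have 1: "\<pi> X Z (Comp C X Y Z g' f') = \<pi> X Z (Comp C X Y Z g f)"
    if g': "g' \<in> \<pi> Y Z g" and f': "f' \<in> \<pi> X Y f" for g' f'
  proof -
    have m: "g' \<in> mor C Y Z" "f' \<in> mor C X Y"
      using that assms subgroup.elemrcos_carrier[OF subgroup_factoring_mors Hom_group]
      unfolding factor_mor_def by blast+
    have i: "diff_mor C Y Z g' g \<in> ideal Y Z" "diff_mor C X Y f' f \<in> ideal X Y"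
      using that assms subgroup.rcos_module_imp[OF subgroup_factoring_mors Hom_group]
      unfolding factor_mor_def by blast+
    have "\<pi> X Z (Comp C X Y Z g' f') = \<pi> X Z (Comp C X Y Z g f')"
      using \<pi>_eqI factoring_mors_Comp_right[OF assms(1-3) m(2) i(1)] assms m
      by (simp add: Comp_diff_left)
    also have "\<dots> = \<pi> X Z (Comp C X Y Z g f)"
      using \<pi>_eqI factoring_mors_Comp_left[OF assms(1-3) i(2) g] assms m
      by (simp add: Comp_diff_right)
    finally show ?thesis .
  qed
  \<comment> \<open>Each coset contains its representative, so the union is not empty.\<close>
  have "g \<in> \<pi> Y Z g" "f \<in> \<pi> X Y f"
    using assms group.rcos_self[OF Hom_group _ subgroup_factoring_mors]
    unfolding factor_mor_def by auto
  then have "(\<Union>g' \<in> \<pi> Y Z g. \<Union>f' \<in> \<pi> X Y f. \<pi> X Z (Comp C X Y Z g' f')) = \<pi> X Z (Comp C X Y Z g f)"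
    using 1 by blast
  then show ?thesis by (simp add: factor_category_def)
qed

text \<open>Every morphism of the quotient has a representative and \<pi> respects sums and
  composites, so each law is inherited from \<open>C\<close>.\<close>

lemma preadditive_category_Q: "preadditive_category Q"
proof (rule preadditive_category.intro)
  show "comm_group (Hom Q X Y)" if "X \<in> Obj Q" "Y \<in> Obj Q" for X Y
    using that comm_group.abelian_FactGroup[OF Hom_comm_group subgroup_factoring_mors]
    by (simp add: Hom_Q)
  show "Ident Q X \<in> mor Q X X" if "X \<in> Obj Q" for X
    using that by (simp add: Ident_Q)
  show "Comp Q X Y Z g f \<in> mor Q X Z"
    if "X \<in> Obj Q" "Y \<in> Obj Q" "Z \<in> Obj Q" "f \<in> mor Q X Y" "g \<in> mor Q Y Z" for X Y Z f g
    using that by (auto dest!: \<pi>_surj)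
  show "Comp Q W X Z (Comp Q X Y Z h g) f = Comp Q W Y Z h (Comp Q W X Y g f)"
    if "W \<in> Obj Q" "X \<in> Obj Q" "Y \<in> Obj Q" "Z \<in> Obj Q"
      "f \<in> mor Q W X" "g \<in> mor Q X Y" "h \<in> mor Q Y Z" for W X Y Z f g h
    using that by (auto dest!: \<pi>_surj simp: Comp_assoc)
  show "Comp Q X Y Y (Ident Q Y) f = f" "Comp Q X X Y f (Ident Q X) = f"
    if "X \<in> Obj Q" "Y \<in> Obj Q" "f \<in> mor Q X Y" for X Y f
    using that by (auto dest!: \<pi>_surj simp: Ident_Q)
  show "Comp Q X Y Z (g \<otimes>\<^bsub>Hom Q Y Z\<^esub> g') f = Comp Q X Y Z g f \<otimes>\<^bsub>Hom Q X Z\<^esub> Comp Q X Y Z g' f"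
    if "X \<in> Obj Q" "Y \<in> Obj Q" "Z \<in> Obj Q" "f \<in> mor Q X Y" "g \<in> mor Q Y Z" "g' \<in> mor Q Y Z"
    for X Y Z f g g'
    using that by (auto dest!: \<pi>_surj simp: \<pi>_add Comp_add_left)
  show "Comp Q X Y Z g (f \<otimes>\<^bsub>Hom Q X Y\<^esub> f') = Comp Q X Y Z g f \<otimes>\<^bsub>Hom Q X Z\<^esub> Comp Q X Y Z g f'"
    if "X \<in> Obj Q" "Y \<in> Obj Q" "Z \<in> Obj Q" "f \<in> mor Q X Y" "f' \<in> mor Q X Y" "g \<in> mor Q Y Z"
    for X Y Z f f' g
    using that by (auto dest!: \<pi>_surj simp: \<pi>_add Comp_add_right)
qed

sublocale Q: preadditive_category Q
  by (rule preadditive_category_Q)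

lemma zero_object_Q:
  assumes Z: "zero_object C Z" shows "zero_object Q Z"
proof -
  have "Z \<in> Obj C" using Z by (simp add: zero_object_def)
  moreover from this have "Ident C Z = zero_mor C Z Z"
    using zero_object_mor_eq(1)[OF Z] by simp
  ultimately show ?thesis by (intro Q.zero_objectI) (simp_all add: Ident_Q \<pi>_zero)
qed

lemma biproduct_Q:
  assumes "biproduct C X Y S i j p q"
  shows "biproduct Q X Y S (\<pi> X S i) (\<pi> Y S j) (\<pi> S X p) (\<pi> S Y q)"
  using assms by (simp add: biproduct_def Ident_Q \<pi>_add \<pi>_zero)

end

lemma additive_category_factor_category:
  assumes "additive_category C" "full_additive_subcategory C F"
  shows "additive_category (factor_category C F)"
proof -
  interpret additive_category C by fact
  interpret factor_by_subcategory C F by unfold_locales fact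
  show ?thesis
  proof
    show "\<exists>Z. zero_object Q Z" using zero_object_Q zero_object_exists by blast
    show "\<exists>S i j p q. biproduct Q X Y S i j p q" if "X \<in> Obj Q" "Y \<in> Obj Q" for X Y
      using biproduct_Q biproduct_exists[of X Y] that by (metis Obj_Q)
  qed
qed

section \<open>Compatibility of the quotient with duality\<close>

lemma full_additive_subcategory_op:
  "full_additive_subcategory C F \<Longrightarrow> full_additive_subcategory (op_cat C) F"
  using additive_category_op[of "full_subcategory C F"]
  by (simp add: full_additive_subcategory_def full_subcategory_def op_cat_def)

lemma factoring_mors_op [simp]: "factoring_mors (op_cat C) F X Y = factoring_mors C F Y X"
  by (auto simp: factoring_mors_def)

lemma factor_mor_op [simp]: "factor_mor (op_cat C) F X Y f = factor_mor C F Y X f"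
  by (simp add: factor_mor_def)

text \<open>For composition the two sides differ only in the order of the two unions. The records
  agree on all arguments, so facts about the opposite data rewrite directly into facts about the
  opposite of the quotient.\<close>

lemma factor_category_op: "factor_category (op_cat C) F = op_cat (factor_category C F)"
proof -
  have "Comp (factor_category (op_cat C) F) X Y Z G H = Comp (op_cat (factor_category C F)) X Y Z G H"
    for X Y Z G H
    unfolding op_cat_simps(3) by (auto simp: factor_category_def)
  moreover have "Obj (factor_category (op_cat C) F) = Obj (op_cat (factor_category C F))"
    "Hom (factor_category (op_cat C) F) = Hom (op_cat (factor_category C F))"
    "Ident (factor_category (op_cat C) F) = Ident (op_cat (factor_category C F))"
    by (simp_all add: factor_category_def op_cat_simps(2,4)[abs_def] fun_eq_iff)
  ultimately show ?thesis by (intro precat.equality ext) auto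
qed

lemma factor_conflations_op:
  assumes "preadditive_category C" "full_additive_subcategory C F"
  shows "factor_conflations (op_cat C) (op_pairs E) F = op_pairs (factor_conflations C E F)"
proof -
  interpret preadditive_category C by fact
  interpret factor_by_subcategory C F by unfold_locales fact
  have "(Z', d', Y', i', X') \<in> factor_conflations (op_cat C) (op_pairs E) F
    \<longleftrightarrow> (Z', d', Y', i', X') \<in> op_pairs (factor_conflations C E F)" for Z' d' Y' i' X'
    unfolding factor_conflations_def
    using Q.isomorphic_pairs_sym by (simp add: factor_category_op isomorphic_pairs_op) blast
  then show ?thesis by (simp add: set_eq_iff)
qed


section \<open>The factor category of a Frobenius category\<close>

text \<open>A locale, since the hypotheses are self-dual: interpreting it at the opposite data
  converts results on deflations, cokernels and projectives into results on inflations, kernels and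
  injectives.\<close>

locale frobenius_factor = frobenius_category A E
  for A :: "('o, 'm) precat" and E :: "('o, 'm) pair set" +
  fixes F :: "'o set"
  assumes full_additive: "full_additive_subcategory A F"
    and F_projective: "W \<in> F \<Longrightarrow> projective_object A E W"
    and left_sequence: "X \<in> Obj A \<Longrightarrow>
      \<exists>FX PX i p. left_approximation A F X FX i \<and> projective_object A E PX \<and>
        pseudo_cokernel A X FX PX i p"
    and right_sequence: "X \<in> Obj A \<Longrightarrow>
      \<exists>PX FX i p. right_approximation A F X FX p \<and> projective_object A E PX \<and>
        pseudo_kernel A PX FX X i p"
begin

sublocale factor_by_subcategory A F
  by unfold_locales (rule full_additive)

abbreviation EF :: "('o, 'm set) pair set" where "EF \<equiv> factor_conflations A E F"

text \<open>Reversal exchanges conditions (1) and (2). The outer terms become injective instead of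
  projective, which is the same in a Frobenius category.\<close>

lemma frobenius_factor_op: "frobenius_factor (op_cat A) (op_pairs E) F"
proof (rule frobenius_factor.intro)
  show "frobenius_category (op_cat A) (op_pairs E)"
    by (rule frobenius_category_op[OF frobenius_category_axioms])
  show "frobenius_factor_axioms (op_cat A) (op_pairs E) F"
  proof
    show "full_additive_subcategory (op_cat A) F"
      by (rule full_additive_subcategory_op[OF full_additive])
    show "\<exists>FX PX i p. left_approximation (op_cat A) F X FX i \<and>
        projective_object (op_cat A) (op_pairs E) PX \<and> pseudo_cokernel (op_cat A) X FX PX i p"
      if "X \<in> Obj (op_cat A)" for X
      using right_sequence[of X] that projective_iff_injective by auto
    show "\<exists>PX FX i p. right_approximation (op_cat A) F X FX p \<and>
        projective_object (op_cat A) (op_pairs E) PX \<and> pseudo_kernel (op_cat A) PX FX X i p"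
      if "X \<in> Obj (op_cat A)" for X
      using left_sequence[of X] that projective_iff_injective by auto
  qed (use F_projective projective_iff_injective in simp)
qed

lemma EF_op: "factor_conflations (op_cat A) (op_pairs E) F = op_pairs EF"
  by (rule factor_conflations_op[OF preadditive_category_axioms full_additive])

text \<open>The first factor of \<open>f\<close> maps \<open>X\<close> into an object of
  \<open>F\<close> and so extends along \<open>i\<close>. Thus one fixed approximation serves all
  morphisms of the ideal starting at \<open>X\<close>.\<close>

lemma ideal_through_left_approximation:
  assumes "left_approximation A F X FX i" "f \<in> ideal X Y" "Y \<in> Obj A"
  shows "\<exists>a \<in> mor A FX Y. Comp A X FX Y a i = f"
  using assms(2)
proof (rule factoring_morsE)
  fix W g h assume W: "W \<in> F" "W \<in> Obj A" "g \<in> mor A X W" "h \<in> mor A W Y" "f = Comp A X W Y h g"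
  have m: "X \<in> Obj A" "FX \<in> Obj A" "i \<in> mor A X FX"
    using assms(1) F_Obj unfolding left_approximation_def by auto
  obtain g' where g': "g' \<in> mor A FX W" "Comp A X FX W g' i = g"
    using assms(1) W unfolding left_approximation_def by blast
  then show ?thesis
    using m W assms(3) by (auto intro!: bexI[of _ "Comp A FX W Y h g'"] simp: Comp_assoc)
qed

lemma ideal_through_right_approximation:
  assumes "right_approximation A F Y FY p" "f \<in> ideal X Y" "X \<in> Obj A"
  shows "\<exists>a \<in> mor A X FY. Comp A X FY Y p a = f"
proof -
  interpret op: frobenius_factor "op_cat A" "op_pairs E" F by (rule frobenius_factor_op)
  show ?thesis using op.ideal_through_left_approximation[of Y FY p f X] assms by simp
qed

text \<open>Projectivity of the objects of \<open>F\<close> makes the image of the square a weak pullback; the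
  uniqueness of the induced morphisms is where condition (1) enters.\<close>

lemma is_pullback_\<pi>:
  assumes pb: "is_pullback A X Y Z f d V u v" and d: "deflation E Y Z d"
  shows "is_pullback Q X Y Z (\<pi> X Z f) (\<pi> Y Z d) V (\<pi> V X u) (\<pi> V Y v)"
proof -
  have ob [simp]: "X \<in> Obj A" "Y \<in> Obj A" "Z \<in> Obj A" "V \<in> Obj A"
    and m [simp]: "f \<in> mor A X Z" "d \<in> mor A Y Z" "u \<in> mor A V X" "v \<in> mor A V Y"
    and e: "Comp A V X Z f u = Comp A V Y Z d v"
    using pb unfolding is_pullback_def by auto
  have univ: "\<exists>w. w \<in> mor A W V \<and> Comp A W V X u w = s \<and> Comp A W V Y v w = t"
    if "W \<in> Obj A" "s \<in> mor A W X" "t \<in> mor A W Y" "Comp A W X Z f s = Comp A W Y Z d t" for W s t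
    using pb that unfolding is_pullback_def by blast
  have "\<exists>!w. w \<in> mor Q W V \<and> Comp Q W V X (\<pi> V X u) w = s \<and> Comp Q W V Y (\<pi> V Y v) w = t"
    if W [simp]: "W \<in> Obj A" and s: "s \<in> mor Q W X" and t: "t \<in> mor Q W Y"
      and st: "Comp Q W X Z (\<pi> X Z f) s = Comp Q W Y Z (\<pi> Y Z d) t" for W s t
  proof -
    obtain s0 where s0 [simp]: "s0 \<in> mor A W X" and s_eq: "s = \<pi> W X s0" using \<pi>_surj[OF s] by blast
    obtain t0 where t0 [simp]: "t0 \<in> mor A W Y" and t_eq: "t = \<pi> W Y t0" using \<pi>_surj[OF t] by blast
    have "diff_mor A W Z (Comp A W X Z f s0) (Comp A W Y Z d t0) \<in> ideal W Z"
      using st unfolding s_eq t_eq by (simp add: \<pi>_eq_iff)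
    then obtain G g h where G: "G \<in> F" and G' [simp]: "G \<in> Obj A" "g \<in> mor A W G" "h \<in> mor A G Z"
      and gh: "diff_mor A W Z (Comp A W X Z f s0) (Comp A W Y Z d t0) = Comp A W G Z h g"
      by (rule factoring_morsE)
    obtain h' where h' [simp]: "h' \<in> mor A G Y" and dh: "Comp A G Y Z d h' = h"
      using projective_lift[OF F_projective[OF G] d, of h] by auto
    \<comment> \<open>The square commutes only up to a map through \<open>G\<close>. Adding the lift
      of this error along \<open>d\<close> to \<open>t0\<close> makes it commute in \<open>A\<close>
      and keeps the class of \<open>t0\<close>.\<close>
    define t1 where "t1 = Comp A W G Y h' g \<otimes>\<^bsub>Hom A W Y\<^esub> t0"
    have t1 [simp]: "t1 \<in> mor A W Y" by (simp add: t1_def)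
    have "Comp A W X Z f s0 = Comp A W G Z h g \<otimes>\<^bsub>Hom A W Z\<^esub> Comp A W Y Z d t0"
      using add_eq_iff_eq_diff[of W Z "Comp A W G Z h g" "Comp A W Y Z d t0" "Comp A W X Z f s0"] gh
      by simp
    also have "\<dots> = Comp A W Y Z d t1"
      by (simp add: t1_def Comp_add_right dh[symmetric] Comp_assoc)
    finally obtain w where w [simp]: "w \<in> mor A W V" and uw: "Comp A W V X u w = s0"
      and vw: "Comp A W V Y v w = t1"
      using univ[OF W s0 t1] by blast
    have "diff_mor A W Y t1 t0 = Comp A W G Y h' g"
      using add_eq_iff_eq_diff[of W Y "Comp A W G Y h' g" t0 t1] by (simp add: t1_def)
    then have "\<pi> W Y t1 = \<pi> W Y t0" using factoring_morsI[OF G] by (simp add: \<pi>_eq_iff)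
    then have ex: "Comp Q W V X (\<pi> V X u) (\<pi> W V w) = s" "Comp Q W V Y (\<pi> V Y v) (\<pi> W V w) = t"
      using uw vw by (simp_all add: s_eq t_eq)
    moreover have "k = \<pi> W V w"
      if k: "k \<in> mor Q W V" and "Comp Q W V X (\<pi> V X u) k = s" "Comp Q W V Y (\<pi> V Y v) k = t" for k
    proof -
      obtain w' where w' [simp]: "w' \<in> mor A W V" and k_eq: "k = \<pi> W V w'" using \<pi>_surj[OF k] by blast
      \<comment> \<open>Uniqueness amounts to \<open>x\<close> lying in the ideal, given that both
        of its components do.\<close>
      define x where "x = diff_mor A W V w' w"
      have x [simp]: "x \<in> mor A W V" by (simp add: x_def)
      have ux: "Comp A W V X u x \<in> ideal W X"
        using that ex by (simp add: k_eq \<pi>_eq_iff[symmetric] Comp_diff_right x_def)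
      have vx: "Comp A W V Y v x \<in> ideal W Y"
        using that ex by (simp add: k_eq \<pi>_eq_iff[symmetric] Comp_diff_right x_def)
      obtain FW PW i p where la: "left_approximation A F W FW i" and PW: "projective_object A E PW"
        and pc: "pseudo_cokernel A W FW PW i p" using left_sequence[OF W] by blast
      have FW: "FW \<in> F" and [simp]: "FW \<in> Obj A" "PW \<in> Obj A" "i \<in> mor A W FW" "p \<in> mor A FW PW"
        and pi_zero: "Comp A W FW PW p i = zero_mor A W PW"
        using la pc F_Obj unfolding left_approximation_def pseudo_cokernel_def composable_pair_def by auto
      obtain a where a [simp]: "a \<in> mor A FW X" and ai: "Comp A W FW X a i = Comp A W V X u x"
        using ideal_through_left_approximation[OF la ux] by auto
      obtain b where b [simp]: "b \<in> mor A FW Y" and bi: "Comp A W FW Y b i = Comp A W V Y v x"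
        using ideal_through_left_approximation[OF la vx] by auto
      have "Comp A W X Z f (Comp A W V X u x) = Comp A W Y Z d (Comp A W V Y v x)"
        by (simp add: Comp_assoc[symmetric] e)
      \<comment> \<open>The components of \<open>x\<close> extend along \<open>i\<close> to
        \<open>a\<close> and \<open>b\<close>, but these need not form a cone. Their defect vanishes
        on \<open>i\<close>, hence factors through the pseudo-cokernel \<open>p\<close> and so
        through \<open>PW\<close>.\<close>
      then have "Comp A W FW Z (diff_mor A FW Z (Comp A FW X Z f a) (Comp A FW Y Z d b)) i = zero_mor A W Z"
        by (simp add: Comp_diff_left Comp_assoc ai bi diff_eq_zero_iff)
      then obtain c where c [simp]: "c \<in> mor A PW Z"
        and cp: "Comp A FW PW Z c p = diff_mor A FW Z (Comp A FW X Z f a) (Comp A FW Y Z d b)"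
        using pc unfolding pseudo_cokernel_def by (metis Comp_closed diff_closed a b m ob \<open>FW \<in> Obj A\<close>)
      obtain c' where c' [simp]: "c' \<in> mor A PW Y" and dc: "Comp A PW Y Z d c' = c"
        using projective_lift[OF PW d c] by auto
      \<comment> \<open>The defect lifts along \<open>d\<close> because \<open>PW\<close> is
        projective. Adding the lift to \<open>b\<close> yields a cone, and the composite with
        \<open>i\<close> is unchanged because \<open>p\<close> kills \<open>i\<close>.\<close>
      define b' where "b' = Comp A FW PW Y c' p \<otimes>\<^bsub>Hom A FW Y\<^esub> b"
      have b' [simp]: "b' \<in> mor A FW Y" by (simp add: b'_def)
      have "Comp A FW X Z f a = Comp A FW PW Z c p \<otimes>\<^bsub>Hom A FW Z\<^esub> Comp A FW Y Z d b"
        using add_eq_iff_eq_diff[of FW Z "Comp A FW PW Z c p" "Comp A FW Y Z d b" "Comp A FW X Z f a"] cp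
        by simp
      also have "\<dots> = Comp A FW Y Z d b'"
        by (simp add: b'_def Comp_add_right dc[symmetric] Comp_assoc)
      finally obtain z where z [simp]: "z \<in> mor A FW V" and uz: "Comp A FW V X u z = a"
        and vz: "Comp A FW V Y v z = b'"
        using univ[of FW a b'] by auto
      have "x = Comp A W FW V z i"
      proof (rule is_pullback_unique[OF pb W])
        show "Comp A W V X u x = Comp A W V X u (Comp A W FW V z i)"
          by (simp add: Comp_assoc[symmetric] uz ai)
        have "Comp A W V Y v (Comp A W FW V z i) = Comp A W FW Y b i"
          using Hom_group[OF W ob(2)]
          by (simp add: Comp_assoc[symmetric] vz b'_def Comp_add_left)
            (simp add: Comp_assoc pi_zero group.is_monoid)
        then show "Comp A W V Y v x = Comp A W V Y v (Comp A W FW V z i)" by (simp add: bi)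
      qed simp_all
      then have "x \<in> ideal W V" using factoring_morsI[OF FW] by simp
      then show ?thesis by (simp add: k_eq \<pi>_eq_iff x_def)
    qed
    ultimately show ?thesis by (intro ex1I[of _ "\<pi> W V w"]) auto
  qed
  then show ?thesis unfolding is_pullback_def by (simp add: e)
qed

text \<open>Condition (2) makes \<open>\<pi>(d)\<close> epic: if \<open>f \<circ> d\<close> lifts to \<open>F\<^sup>W\<close> along the right approximation
  \<open>p\<close> of \<open>W\<close>, the lift restricted along \<open>i\<close> factors through the injective \<open>P\<^sup>W\<close>, so it can
  be corrected to vanish on \<open>i\<close> and hence to descend to a lift of \<open>f\<close>.\<close>

lemma ideal_cancel_deflation:
  assumes c: "(X, i, Y, d, Z) \<in> E" and W [simp]: "W \<in> Obj A" and f [simp]: "f \<in> mor A Z W"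
    and fd: "Comp A Y Z W f d \<in> ideal Y W"
  shows "f \<in> ideal Z W"
proof -
  note [simp] = conflation_composable[OF c]
  obtain PW FW k p where ra: "right_approximation A F W FW p" and PW: "projective_object A E PW"
    and pk: "pseudo_kernel A PW FW W k p" using right_sequence[OF W] by blast
  have FW: "FW \<in> F" and [simp]: "FW \<in> Obj A" "PW \<in> Obj A" "k \<in> mor A PW FW" "p \<in> mor A FW W"
    and pk_zero: "Comp A PW FW W p k = zero_mor A PW W"
    using ra pk F_Obj unfolding right_approximation_def pseudo_kernel_def composable_pair_def by auto
  obtain g where g [simp]: "g \<in> mor A Y FW" and pg: "Comp A Y FW W p g = Comp A Y Z W f d"
    using ideal_through_right_approximation[OF ra fd] by auto
  have "Comp A X FW W p (Comp A X Y FW g i) = zero_mor A X W"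
    by (simp add: Comp_assoc[symmetric] pg) (simp add: Comp_assoc)
  then obtain t where t [simp]: "t \<in> mor A X PW" and kt: "Comp A X PW FW k t = Comp A X Y FW g i"
    using pk unfolding pseudo_kernel_def by (metis Comp_closed conflation_composable[OF c] g \<open>FW \<in> Obj A\<close>)
  obtain s where s [simp]: "s \<in> mor A Y PW" and si: "Comp A X Y PW s i = t"
    using injective_extend[OF _ _ t, of Y i] PW projective_iff_injective c unfolding inflation_def by auto
  have "Comp A X Y FW (diff_mor A Y FW g (Comp A Y PW FW k s)) i = zero_mor A X FW"
    by (simp add: Comp_diff_left Comp_assoc si kt diff_eq_zero_iff)
  then obtain l where l [simp]: "l \<in> mor A Z FW"
    and ld: "Comp A Y Z FW l d = diff_mor A Y FW g (Comp A Y PW FW k s)"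
    using conflation_cokernel[OF c] unfolding is_cokernel_def
    by (metis Comp_closed diff_closed conflation_composable(2)[OF c] g s \<open>FW \<in> Obj A\<close> \<open>PW \<in> Obj A\<close> \<open>k \<in> mor A PW FW\<close>)
  \<comment> \<open>The correction disappears after \<open>p\<close>, since \<open>p\<close> kills
    \<open>k\<close>; so \<open>p\<close> after \<open>l\<close> agrees with \<open>f\<close> on the
    epimorphism \<open>d\<close>.\<close>
  have "Comp A Y PW W (Comp A PW FW W p k) s = zero_mor A Y W" by (simp add: pk_zero)
  then have "Comp A Y Z W (Comp A Z FW W p l) d = Comp A Y Z W f d"
    using Hom_group[of Y W]
    by (simp add: Comp_assoc ld Comp_diff_right pg group.is_monoid monoid.inv_one)
  moreover have "\<exists>!h. h \<in> mor A Z W \<and> Comp A Y Z W h d = Comp A Y Z W f d"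
  proof -
    have "Comp A X Y W (Comp A Y Z W f d) i = zero_mor A X W" by (simp add: Comp_assoc)
    then show ?thesis using conflation_cokernel[OF c] unfolding is_cokernel_def by simp
  qed
  ultimately have "f = Comp A Z FW W p l" by (metis Comp_closed W f l \<open>FW \<in> Obj A\<close> \<open>p \<in> mor A FW W\<close> conflation_composable(3)[OF c])
  then show ?thesis using factoring_morsI[OF FW] by simp
qed

text \<open>For existence, the composite of a representative with \<open>i\<close> factors through
  an object of \<open>F\<close>; as that object is injective, the factorisation extends over
  \<open>Y\<close> and can be subtracted, after which the cokernel in \<open>A\<close> applies.
  Uniqueness is \<open>ideal_cancel_deflation\<close>.\<close>

lemma is_cokernel_\<pi>:
  assumes c: "(X, i, Y, d, Z) \<in> E"
  shows "is_cokernel Q X Y Z (\<pi> X Y i) (\<pi> Y Z d)"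
proof -
  note [simp] = conflation_composable[OF c]
  have "\<exists>!k. k \<in> mor Q Z W \<and> Comp Q Y Z W k (\<pi> Y Z d) = f"
    if W [simp]: "W \<in> Obj A" and f: "f \<in> mor Q Y W" and fi: "Comp Q X Y W f (\<pi> X Y i) = zero_mor Q X W"
    for W f
  proof -
    obtain f0 where f0 [simp]: "f0 \<in> mor A Y W" and f_eq: "f = \<pi> Y W f0" using \<pi>_surj[OF f] by blast
    have "Comp A X Y W f0 i \<in> ideal X W" using fi by (simp add: f_eq \<pi>_eq_zero_iff)
    then obtain G g h where G: "G \<in> F" and G' [simp]: "G \<in> Obj A" "g \<in> mor A X G" "h \<in> mor A G W"
      and gh: "Comp A X Y W f0 i = Comp A X G W h g"
      by (rule factoring_morsE)
    obtain g' where g' [simp]: "g' \<in> mor A Y G" and gi: "Comp A X Y G g' i = g"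
      using injective_extend[OF _ _ G'(2), of Y i] F_projective[OF G] projective_iff_injective c
      unfolding inflation_def by auto
    have "Comp A X Y W (diff_mor A Y W f0 (Comp A Y G W h g')) i = zero_mor A X W"
      by (simp add: Comp_diff_left Comp_assoc gi gh diff_eq_zero_iff)
    then obtain k where k [simp]: "k \<in> mor A Z W"
      and kd: "Comp A Y Z W k d = diff_mor A Y W f0 (Comp A Y G W h g')"
      using conflation_cokernel[OF c] unfolding is_cokernel_def
      by (metis Comp_closed diff_closed conflation_composable(2)[OF c] f0 W G' g')
    have "diff_mor A Y W f0 (Comp A Y Z W k d) = Comp A Y G W h g'"
      by (simp add: kd diff_diff)
    then have "\<pi> Y W f0 = \<pi> Y W (Comp A Y Z W k d)"
      using factoring_morsI[OF G] by (simp add: \<pi>_eq_iff)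
    then have "Comp Q Y Z W (\<pi> Z W k) (\<pi> Y Z d) = f" by (simp add: f_eq)
    moreover have "k' = \<pi> Z W k" if k': "k' \<in> mor Q Z W" "Comp Q Y Z W k' (\<pi> Y Z d) = f" for k'
    proof -
      obtain k0 where k0 [simp]: "k0 \<in> mor A Z W" and k_eq: "k' = \<pi> Z W k0" using \<pi>_surj[OF k'(1)] by blast
      have "Comp A Y Z W (diff_mor A Z W k0 k) d \<in> ideal Y W"
        using k'(2) \<open>Comp Q Y Z W (\<pi> Z W k) (\<pi> Y Z d) = f\<close>
        by (simp add: k_eq \<pi>_eq_iff[symmetric] Comp_diff_left)
      then show ?thesis using ideal_cancel_deflation[OF c W] by (simp add: k_eq \<pi>_eq_iff)
    qed
    ultimately show ?thesis by (intro ex1I[of _ "\<pi> Z W k"]) auto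
  qed
  then show ?thesis unfolding is_cokernel_def composable_pair_def by (simp add: \<pi>_zero)
qed

lemma is_kernel_\<pi>:
  assumes c: "(X, i, Y, d, Z) \<in> E"
  shows "is_kernel Q X Y Z (\<pi> X Y i) (\<pi> Y Z d)"
proof -
  interpret op: frobenius_factor "op_cat A" "op_pairs E" F by (rule frobenius_factor_op)
  show ?thesis using op.is_cokernel_\<pi>[of Z d Y i X] c by (simp add: factor_category_op)
qed

section \<open>Conflations and deflations of the quotient\<close>

lemma EF_iff:
  "(X', i', Y', d', Z') \<in> EF \<longleftrightarrow> (\<exists>X i Y d Z. (X, i, Y, d, Z) \<in> E \<and>
    isomorphic_pairs Q (X, \<pi> X Y i, Y, \<pi> Y Z d, Z) (X', i', Y', d', Z'))"
  by (simp add: factor_conflations_def)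

lemma EF_kernel: "(X, i, Y, d, Z) \<in> EF \<Longrightarrow> is_kernel Q X Y Z i d"
  unfolding EF_iff using Q.is_kernel_isomorphic is_kernel_\<pi> by blast

lemma EF_cokernel: "(X, i, Y, d, Z) \<in> EF \<Longrightarrow> is_cokernel Q X Y Z i d"
proof -
  interpret op: frobenius_factor "op_cat A" "op_pairs E" F by (rule frobenius_factor_op)
  show "(X, i, Y, d, Z) \<in> EF \<Longrightarrow> is_cokernel Q X Y Z i d"
    using op.EF_kernel[of Z d Y i X] by (simp add: factor_category_op EF_op)
qed

text \<open>An isomorphism of pairs need only be given on its right half: the left end can be kept
  as \<open>X\<close>, with identity comparison and inclusion \<open>b\<close> after
  \<open>\<pi> X Y i\<close>. Kernels then drop out of the arguments on deflations.\<close>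

lemma deflation_EF_iff:
  "deflation EF Y' Z' d' \<longleftrightarrow> Y' \<in> Obj A \<and> Z' \<in> Obj A \<and> d' \<in> mor Q Y' Z' \<and>
    (\<exists>Y Z d b c. deflation E Y Z d \<and> is_iso Q Y Y' b \<and> is_iso Q Z Z' c \<and>
      Comp Q Y Z Z' c (\<pi> Y Z d) = Comp Q Y Y' Z' d' b)" (is "?L \<longleftrightarrow> ?R")
proof
  assume ?L
  then obtain X' i' X i Y d Z where c: "(X, i, Y, d, Z) \<in> E"
    and iso: "isomorphic_pairs Q (X, \<pi> X Y i, Y, \<pi> Y Z d, Z) (X', i', Y', d', Z')"
    unfolding deflation_def EF_iff by blast
  then have d: "deflation E Y Z d" unfolding deflation_def by blast
  obtain b c where "is_iso Q Y Y' b" "is_iso Q Z Z' c" "Comp Q Y Z Z' c (\<pi> Y Z d) = Comp Q Y Y' Z' d' b"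
    "Y' \<in> Obj A" "Z' \<in> Obj A" "d' \<in> mor Q Y' Z'"
    using iso unfolding isomorphic_pairs_def composable_pair_def by auto
  then show ?R using d by blast
next
  assume R: ?R
  then obtain Y Z d b c where d: "deflation E Y Z d" and b: "is_iso Q Y Y' b" and c: "is_iso Q Z Z' c"
    and e: "Comp Q Y Z Z' c (\<pi> Y Z d) = Comp Q Y Y' Z' d' b" by blast
  have [simp]: "b \<in> mor Q Y Y'" using b by (simp add: is_iso_def)
  obtain X i where E: "(X, i, Y, d, Z) \<in> E" using d unfolding deflation_def by blast
  note [simp] = conflation_composable[OF E]
  have "isomorphic_pairs Q (X, \<pi> X Y i, Y, \<pi> Y Z d, Z) (X, Comp Q X Y Y' b (\<pi> X Y i), Y', d', Z')"
    unfolding isomorphic_pairs_def composable_pair_def prod.case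
    using R b c e Q.is_iso_Ident[of X]
    by (intro conjI exI[of _ "Ident Q X"] exI[of _ b] exI[of _ c]) simp_all
  then show ?L using E unfolding deflation_def EF_iff by blast
qed

lemma deflation_EF_\<pi>:
  assumes "deflation E Y Z d" shows "deflation EF Y Z (\<pi> Y Z d)"
  using deflation_mor[OF assms] assms Q.is_iso_Ident[of Y] Q.is_iso_Ident[of Z]
  unfolding deflation_EF_iff
  by (intro conjI exI[of _ Y] exI[of _ Z] exI[of _ d] exI[of _ "Ident Q Y"] exI[of _ "Ident Q Z"]) simp_all

text \<open>A zero object of the quotient need not be zero in \<open>A\<close>, as the objects of
  \<open>F\<close> show. Its identity is compared with that of a zero object of \<open>A\<close>
  through the isomorphism between the two in the quotient.\<close>

lemma zero_deflation_EF:
  assumes Z: "zero_object Q Z" shows "deflation EF Z Z (Ident Q Z)"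
proof -
  obtain O' where O': "zero_object A O'" using zero_object_exists by blast
  have ob: "Z \<in> Obj A" "O' \<in> Obj A" using Z O' by (auto simp: zero_object_def)
  note iso = Q.is_iso_zero[OF zero_object_Q[OF O'] Z]
  have "Comp Q O' O' Z (zero_mor Q O' Z) (\<pi> O' O' (Ident A O')) = Comp Q O' Z Z (Ident Q Z) (zero_mor Q O' Z)"
    using Q.zero_object_mor_eq(1)[OF Z, of O'] ob by simp
  then show ?thesis unfolding deflation_EF_iff using zero_deflation[OF O'] iso ob Q.Ident_closed
    by (metis Obj_Q)
qed

text \<open>The isomorphism in \<open>\<A>/[\<F>]\<close> that separates the two deflations need not be the image of an
  isomorphism; pulling the first deflation back along any representative of it absorbs it.\<close>

lemma deflation_Comp_EF:
  assumes d: "deflation EF X Y d" and e: "deflation EF Y Z e"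
  shows "deflation EF X Z (Comp Q X Y Z e d)"
proof -
  obtain X0 Y0 d0 b c where d0: "deflation E X0 Y0 d0" and b: "is_iso Q X0 X b" and c: "is_iso Q Y0 Y c"
    and de: "Comp Q X0 Y0 Y c (\<pi> X0 Y0 d0) = Comp Q X0 X Y d b"
    and ob1 [simp]: "X \<in> Obj A" "Y \<in> Obj A" "d \<in> mor Q X Y"
    using d unfolding deflation_EF_iff by blast
  obtain Y1 Z1 e1 b1 c1 where e1: "deflation E Y1 Z1 e1" and b1: "is_iso Q Y1 Y b1" and c1: "is_iso Q Z1 Z c1"
    and ee: "Comp Q Y1 Z1 Z c1 (\<pi> Y1 Z1 e1) = Comp Q Y1 Y Z e b1"
    and ob2 [simp]: "Z \<in> Obj A" "e \<in> mor Q Y Z"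
    using e unfolding deflation_EF_iff by blast
  have [simp]: "X0 \<in> Obj A" "Y0 \<in> Obj A" "Y1 \<in> Obj A" "Z1 \<in> Obj A" "d0 \<in> mor A X0 Y0" "e1 \<in> mor A Y1 Z1"
    using deflation_mor d0 e1 by blast+
  have [simp]: "b \<in> mor Q X0 X" "b1 \<in> mor Q Y1 Y" "c1 \<in> mor Q Z1 Z"
    using b b1 c1 by (simp_all add: is_iso_def)
  obtain c' where c' [simp]: "c \<in> mor Q Y0 Y" "c' \<in> mor Q Y Y0" "is_iso Q Y Y0 c'"
    and cc: "Comp Q Y0 Y Y0 c' c = Ident Q Y0" "Comp Q Y Y0 Y c c' = Ident Q Y"
    by (rule Q.is_isoE[OF c])
  have iso: "is_iso Q Y1 Y0 (Comp Q Y1 Y Y0 c' b1)"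
    by (rule Q.is_iso_Comp[OF b1 c'(3)]) simp_all
  then obtain \<psi> where \<psi> [simp]: "\<psi> \<in> mor A Y1 Y0" and \<psi>_eq: "Comp Q Y1 Y Y0 c' b1 = \<pi> Y1 Y0 \<psi>"
    using \<pi>_surj by (metis is_iso_def)
  obtain V u v where pb: "is_pullback A Y1 X0 Y0 \<psi> d0 V u v" and u: "deflation E V Y1 u"
    using deflation_pullback[OF d0 _ \<psi>] by auto
  have [simp]: "V \<in> Obj A" "u \<in> mor A V Y1" "v \<in> mor A V X0"
    and sq: "Comp A V Y1 Y0 \<psi> u = Comp A V X0 Y0 d0 v"
    using pb unfolding is_pullback_def by auto
  \<comment> \<open>The pullback square stays a pullback in the quotient, and there
    \<open>\<psi>\<close> represents an isomorphism, so its parallel side \<open>v\<close> does as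
    well.\<close>
  have v: "is_iso Q V X0 (\<pi> V X0 v)"
    using Q.is_pullback_iso[OF is_pullback_\<pi>[OF pb d0]] iso by (simp add: \<psi>_eq)
  \<comment> \<open>The computation compares the given composite with the image of \<open>e1\<close>
    after \<open>u\<close>, a deflation of \<open>A\<close>, along the isomorphisms \<open>b\<close>
    after the class of \<open>v\<close> and \<open>c1\<close>.\<close>
  have "Comp Q V X Z (Comp Q X Y Z e d) (Comp Q V X0 X b (\<pi> V X0 v))
      = Comp Q V Y Z e (Comp Q V X0 Y (Comp Q X0 X Y d b) (\<pi> V X0 v))"
    by (simp add: Q.Comp_assoc)
  also have "\<dots> = Comp Q V Y Z e (Comp Q V Y0 Y c (\<pi> V Y0 (Comp A V X0 Y0 d0 v)))"
    by (simp add: de[symmetric] Q.Comp_assoc)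
  also have "\<dots> = Comp Q V Y Z e (Comp Q V Y0 Y c (Comp Q V Y1 Y0 (Comp Q Y1 Y Y0 c' b1) (\<pi> V Y1 u)))"
    by (simp add: \<psi>_eq sq)
  also have "\<dots> = Comp Q V Y Z e (Comp Q V Y1 Y b1 (\<pi> V Y1 u))"
    by (simp add: Q.Comp_assoc Q.Comp_cancel[OF _ _ _ _ cc(2)])
  also have "\<dots> = Comp Q V Y1 Z (Comp Q Y1 Y Z e b1) (\<pi> V Y1 u)"
    by (simp add: Q.Comp_assoc)
  also have "\<dots> = Comp Q V Z1 Z c1 (\<pi> V Z1 (Comp A V Y1 Z1 e1 u))"
    by (simp add: ee[symmetric] Q.Comp_assoc)
  finally have *: "Comp Q V Z1 Z c1 (\<pi> V Z1 (Comp A V Y1 Z1 e1 u))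
      = Comp Q V X Z (Comp Q X Y Z e d) (Comp Q V X0 X b (\<pi> V X0 v))" by simp
  have "is_iso Q V X (Comp Q V X0 X b (\<pi> V X0 v))"
    by (rule Q.is_iso_Comp[OF v b]) simp_all
  then show ?thesis
    unfolding deflation_EF_iff using deflation_Comp[OF u e1] c1 *
    by (intro conjI) (simp, simp, simp, blast)
qed

text \<open>Move \<open>f\<close> across the inverse of \<open>c\<close>, choose a representative
  and pull the deflation \<open>d0\<close> back in \<open>A\<close>. The image of that square is a
  pullback, and transport along \<open>b\<close> and \<open>c\<close> replaces \<open>d0\<close> by
  \<open>d\<close>.\<close>

lemma deflation_pullback_EF:
  assumes d: "deflation EF Y Z d" and X [simp]: "X \<in> Obj A" and f [simp]: "f \<in> mor Q X Z"
  shows "\<exists>V d' f'. is_pullback Q X Y Z f d V d' f' \<and> deflation EF V X d'"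
proof -
  obtain Y0 Z0 d0 b c where d0: "deflation E Y0 Z0 d0" and b: "is_iso Q Y0 Y b" and c: "is_iso Q Z0 Z c"
    and de: "Comp Q Y0 Z0 Z c (\<pi> Y0 Z0 d0) = Comp Q Y0 Y Z d b"
    and ob1 [simp]: "Y \<in> Obj A" "Z \<in> Obj A" "d \<in> mor Q Y Z"
    using d unfolding deflation_EF_iff by blast
  have [simp]: "Y0 \<in> Obj A" "Z0 \<in> Obj A" "d0 \<in> mor A Y0 Z0"
    using deflation_mor d0 by blast+
  obtain c' where c' [simp]: "c \<in> mor Q Z0 Z" "c' \<in> mor Q Z Z0"
    and cc: "Comp Q Z0 Z Z0 c' c = Ident Q Z0" "Comp Q Z Z0 Z c c' = Ident Q Z"
    by (rule Q.is_isoE[OF c])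
  obtain f0 where f0 [simp]: "f0 \<in> mor A X Z0" and f0_eq: "Comp Q X Z Z0 c' f = \<pi> X Z0 f0"
    using \<pi>_surj[of "Comp Q X Z Z0 c' f" X Z0] by auto
  obtain V u v where pb: "is_pullback A X Y0 Z0 f0 d0 V u v" and u: "deflation E V X u"
    using deflation_pullback[OF d0 X f0] by auto
  have "f = Comp Q X Z0 Z c (\<pi> X Z0 f0)"
    by (simp add: f0_eq[symmetric] Q.Comp_cancel[OF _ _ _ _ cc(2)])
  then have "is_pullback Q X Y Z f d V (\<pi> V X u) (Comp Q V Y0 Y b (\<pi> V Y0 v))"
    using Q.is_pullback_transport[OF is_pullback_\<pi>[OF pb d0] _ _ b c f _ ob1(3)] de by simp
  then show ?thesis using deflation_EF_\<pi>[OF u] by blast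
qed

section \<open>Projective objects of the quotient\<close>

lemma projective_EF_iff: "projective_object Q EF P \<longleftrightarrow> projective_object A E P"
proof
  assume P: "projective_object A E P"
  then have [simp]: "P \<in> Obj A" by (simp add: projective_object_def)
  have "\<exists>h \<in> mor Q P Y. Comp Q P Y Z d h = g" if d: "deflation EF Y Z d" and g [simp]: "g \<in> mor Q P Z" for Y Z d g
  proof -
    obtain Y0 Z0 d0 b c where d0: "deflation E Y0 Z0 d0" and b: "is_iso Q Y0 Y b" and c: "is_iso Q Z0 Z c"
      and de: "Comp Q Y0 Z0 Z c (\<pi> Y0 Z0 d0) = Comp Q Y0 Y Z d b"
      and [simp]: "Y \<in> Obj A" "Z \<in> Obj A" "d \<in> mor Q Y Z"
      using d unfolding deflation_EF_iff by blast
    have [simp]: "Y0 \<in> Obj A" "Z0 \<in> Obj A" "d0 \<in> mor A Y0 Z0" "b \<in> mor Q Y0 Y"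
      using deflation_mor d0 b by (blast, blast, blast, simp add: is_iso_def)
    obtain c' where c' [simp]: "c \<in> mor Q Z0 Z" "c' \<in> mor Q Z Z0"
      and cc: "Comp Q Z0 Z Z0 c' c = Ident Q Z0" "Comp Q Z Z0 Z c c' = Ident Q Z"
      by (rule Q.is_isoE[OF c])
    \<comment> \<open>The lifting problem is moved across the inverse of \<open>c\<close> to a
      deflation of \<open>A\<close> and solved for a representative there; \<open>b\<close> brings
      the solution back.\<close>
    obtain g0 where g0 [simp]: "g0 \<in> mor A P Z0" and g0_eq: "Comp Q P Z Z0 c' g = \<pi> P Z0 g0"
      using \<pi>_surj[of "Comp Q P Z Z0 c' g" P Z0] by auto
    obtain h where h [simp]: "h \<in> mor A P Y0" and dh: "Comp A P Y0 Z0 d0 h = g0"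
      using projective_lift[OF P d0 g0] by blast
    have "Comp Q P Y Z d (Comp Q P Y0 Y b (\<pi> P Y0 h)) = Comp Q P Z0 Z c (\<pi> P Z0 g0)"
      by (simp add: Q.Comp_assoc[symmetric] de[symmetric]) (simp add: Q.Comp_assoc dh)
    also have "\<dots> = g" by (simp add: g0_eq[symmetric] Q.Comp_cancel[OF _ _ _ _ cc(2)])
    finally show ?thesis by (intro bexI[of _ "Comp Q P Y0 Y b (\<pi> P Y0 h)"]) simp_all
  qed
  then show "projective_object Q EF P" using Q.projective_object_iff[OF EF_kernel] by simp
next
  assume P: "projective_object Q EF P"
  then have P' [simp]: "P \<in> Obj A" by (simp add: projective_object_def)
  \<comment> \<open>It suffices to split one deflation from a projective object onto
    \<open>P\<close>. Projectivity in the quotient splits its image.\<close>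
  obtain R d where R: "projective_object A E R" and d: "deflation E R P d"
    using enough_projectives unfolding enough_projectives_def by (meson P')
  have [simp]: "R \<in> Obj A" "d \<in> mor A R P" using deflation_mor[OF d] by auto
  have "\<exists>h \<in> mor Q P R. Comp Q P R P (\<pi> R P d) h = Ident Q P"
    using P deflation_EF_\<pi>[OF d] Q.projective_object_iff[OF EF_kernel] Q.Ident_closed by simp
  then obtain s1 where s1: "s1 \<in> mor Q P R" and ds1: "Comp Q P R P (\<pi> R P d) s1 = Ident Q P"
    by blast
  obtain s where s [simp]: "s \<in> mor A P R" and s1_eq: "s1 = \<pi> P R s"
    using \<pi>_surj[OF s1] by blast
  have "\<pi> P P (Comp A P R P d s) = \<pi> P P (Ident A P)"
    using ds1 by (simp add: s1_eq Ident_Q)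
  then have "diff_mor A P P (Comp A P R P d s) (Ident A P) \<in> ideal P P" by (simp add: \<pi>_eq_iff)
  then obtain G g h where G: "G \<in> F" and [simp]: "G \<in> Obj A" "g \<in> mor A P G" "h \<in> mor A G P"
    and gh: "diff_mor A P P (Comp A P R P d s) (Ident A P) = Comp A P G P h g"
    by (rule factoring_morsE)
  obtain h' where h' [simp]: "h' \<in> mor A G R" and dh: "Comp A G R P d h' = h"
    using projective_lift[OF F_projective[OF G] d, of h] by auto
  \<comment> \<open>The error of the splitting factors through the projective \<open>G\<close>, so
    it lifts along \<open>d\<close>; subtracting the lift gives a genuine section in
    \<open>A\<close>.\<close>
  define s' where "s' = diff_mor A P R s (Comp A P G R h' g)"
  have s' [simp]: "s' \<in> mor A P R" by (simp add: s'_def)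
  have "Comp A P R P d s' = diff_mor A P P (Comp A P R P d s) (Comp A P G P h g)"
    by (simp add: s'_def Comp_diff_right dh[symmetric] Comp_assoc)
  also have "\<dots> = Ident A P" by (simp add: gh[symmetric] diff_diff)
  finally have ds': "Comp A P R P d s' = Ident A P" .
  \<comment> \<open>\<open>P\<close> is a retract of \<open>R\<close> and inherits its lifting
    property.\<close>
  have "\<exists>k \<in> mor A P Y. Comp A P Y Z e k = g" if e: "deflation E Y Z e" and g [simp]: "g \<in> mor A P Z" for Y Z e g
  proof -
    have [simp]: "Y \<in> Obj A" "Z \<in> Obj A" "e \<in> mor A Y Z" using deflation_mor[OF e] by auto
    obtain k where k [simp]: "k \<in> mor A R Y" and ek: "Comp A R Y Z e k = Comp A R P Z g d"
      using projective_lift[OF R e, of "Comp A R P Z g d"] by auto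
    have "Comp A P Y Z e (Comp A P R Y k s') = g"
      by (simp add: Comp_assoc[symmetric] ek) (simp add: Comp_assoc ds')
    then show ?thesis by (intro bexI[of _ "Comp A P R Y k s'"]) simp_all
  qed
  then show "projective_object A E P" using projective_object_iff[OF conflation_kernel] by simp
qed

section \<open>Assembly of the Frobenius structure\<close>

lemma enough_projectives_EF: "enough_projectives Q EF"
  using enough_projectives projective_EF_iff deflation_EF_\<pi> unfolding enough_projectives_def Obj_Q by blast

theorem frobenius_category_Q: "frobenius_category Q EF"
proof -
  interpret op: frobenius_factor "op_cat A" "op_pairs E" F by (rule frobenius_factor_op)
  note op_eq = factor_category_op EF_op
  show ?thesis
  proof (intro frobenius_category.intro exact_category.intro exact_category_axioms.intro
      frobenius_category_axioms.intro)
    show "additive_category Q"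
      by (rule additive_category_factor_category[OF additive_category_axioms full_additive])
    show "kernel_cokernel_pair Q c" if "c \<in> EF" for c
      using that EF_kernel EF_cokernel by (cases c) (auto simp: kernel_cokernel_pair_def)
    show "c' \<in> EF" if "c \<in> EF" "isomorphic_pairs Q c c'" for c c'
      using that Q.isomorphic_pairs_trans unfolding factor_conflations_def by blast
    show "inflation EF X Z (Comp Q X Y Z j i)" if "inflation EF X Y i" "inflation EF Y Z j" for X Y Z i j
      using op.deflation_Comp_EF[of Z Y j X i] that by (simp add: op_eq)
    show "\<exists>V i' f'. is_pushout Q X Y Z f i V i' f' \<and> inflation EF X V i'"
      if "inflation EF Z Y i" "X \<in> Obj Q" "f \<in> mor Q Z X" for X Y Z f i
      using op.deflation_pullback_EF[of Y Z i X f] that by (simp add: op_eq)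
    show "enough_injectives Q EF"
      using op.enough_projectives_EF by (simp add: op_eq)
    \<comment> \<open>Both notions reduce to \<open>A\<close>: projectives directly, injectives as
      the projectives of the opposite quotient. In \<open>A\<close> they coincide.\<close>
    show "projective_object Q EF X \<longleftrightarrow> injective_object Q EF X" for X
      using projective_EF_iff[of X] op.projective_EF_iff[of X] projective_iff_injective[of X]
      by (simp add: op_eq)
  qed (use zero_deflation_EF deflation_Comp_EF deflation_pullback_EF enough_projectives_EF in auto)
qed

end

theorem theorem3p1:
  fixes A :: "('o, 'm) precat" and E :: "('o, 'm) pair set" and F :: "'o set"
  assumes "frobenius_category A E"
    and "full_additive_subcategory A F"
    and "F \<subseteq> {P. projective_object A E P}"
    and "\<And>X. X \<in> Obj A \<Longrightarrow>
      \<exists>FX PX i p. left_approximation A F X FX i \<and> projective_object A E PX \<and>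
        pseudo_cokernel A X FX PX i p"
    and "\<And>X. X \<in> Obj A \<Longrightarrow>
      \<exists>PX FX i p. right_approximation A F X FX p \<and> projective_object A E PX \<and>
        pseudo_kernel A PX FX X i p"
  shows "frobenius_category (factor_category A F) (factor_conflations A E F)"
proof -
  interpret frobenius_factor A E F
    using assms by (intro frobenius_factor.intro frobenius_factor_axioms.intro) auto
  show ?thesis by (rule frobenius_category_Q)
qed

end
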